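(* Assume that $\mathsf{C}$ is symmetric and let $(T\colon H\to B,\varphi_H)$ be a relative Rota-Baxter operator in $\mathsf{C}$ such that both Hopf algebras $H$ and $B$ are cocommutative. Then the category ${}_{(T,\varphi_H)}\mathsf{Mod}$ of left modules over $(T\colon H\to B,\varphi_H)$ is monoidal with unit object $(K,K,\varepsilon_H,\varepsilon_B,\varepsilon_B,id_K)$ and tensor functor given on objects by $$\big((M,N,\phi_M,\varphi_M,\varphi_N,\gamma),(P,Q,\phi_P,\varphi_P,\varphi_Q,\theta)\big)\longmapsto (M\otimes P,N\otimes Q,\phi_{M\otimes P},\varphi_{M\otimes P},\varphi_{N\otimes Q},\gamma\otimes\theta),$$ where $\phi_{M\otimes P}$, $\varphi_{M\otimes P}$, $\varphi_{N\otimes Q}$ are the diagonal tensor actions. Moreover, ${}_{(T,\varphi_H)}\mathsf{Mod}$ is symmetric, with symmetry isomorphism given by $\tau_{(M,N,\gamma),(P,Q,\theta)}=(c_{M,P},c_{N,Q})$.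
   Context: $\mathsf{C}$ is a strict braided monoidal category with tensor product $\otimes$, unit object $K$ and braiding $c$; it is symmetric if $c_{N,M}\circ c_{M,N}=id_{M\otimes N}$ for all $M,N$. For an object $P$ and a morphism $f$, write $P\otimes f$ for $id_P\otimes f$ and $f\otimes P$ for $f\otimes id_P$. (Co)algebras, Hopf algebras and modules are taken in $\mathsf{C}$. A Hopf algebra is written $X=(X,\eta_X,\mu_X,\varepsilon_X,\delta_X,\lambda_X)$ (unit, product, counit, coproduct, antipode); it is cocommutative if $c_{X,X}\circ\delta_X=\delta_X$. Tensor products of algebras and coalgebras carry $\mu_{A\otimes B}=(\mu_A\otimes\mu_B)\circ(A\otimes c_{B,A}\otimes B)$ and $\delta_{D\otimes E}=(D\otimes c_{D,E}\otimes E)\circ(\delta_D\otimes\delta_E)$. For a Hopf algebra $X$ and an algebra-coalgebra $A$, $(A,\varphi_A)$ is a left $X$-module algebra-coalgebra if $(A,\varphi_A)$ is a left $X$-module, $\varphi_A\circ(X\otimes\eta_A)=\varepsilon_X\otimes\eta_A$, $\varphi_A\circ(X\otimes\mu_A)=\mu_A\circ(\varphi_A\otimes\varphi_A)\circ(X\otimes c_{X,A}\otimes A)\circ(\delta_X\otimes A\otimes A)$, and $\varphi_A\colon X\otimes A\to A$ is a coalgebra morphism. Relative Rota-Baxter operator $(T\colon H\to B,\varphi_H)$: $H$, $B$ are Hopf algebras, $(H,\varphi_H)$ is a left $B$-module algebra-coalgebra and $T\colon H\to B$ is a coalgebra morphism with $\mu_B\circ(T\otimes T)=T\circ\mu_H\circ(H\otimes(\varphi_H\circ(T\otimes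 H)))\circ(\delta_H\otimes H)$. A left module over $(T\colon H\to B,\varphi_H)$ is a 6-tuple $(M,N,\phi_M,\varphi_M,\varphi_N,\gamma)$ such that: (i) $(M,\phi_M)$ is a left $H$-module, $(M,\varphi_M)$ is a left $B$-module and $\varphi_M\circ(B\otimes\phi_M)=\phi_M\circ(\varphi_H\otimes\varphi_M)\circ(B\otimes c_{B,H}\otimes M)\circ(\delta_B\otimes H\otimes M)$; (ii) $(N,\varphi_N)$ is a left $B$-module; (iii) $\gamma\colon M\to N$ is a morphism in $\mathsf{C}$ with $\varphi_N\circ(T\otimes\gamma)=\gamma\circ\phi_M\circ(H\otimes(\varphi_M\circ(T\otimes M)))\circ(\delta_H\otimes M)$. A morphism $(M,N,\phi_M,\varphi_M,\varphi_N,\gamma)\to(P,Q,\phi_P,\varphi_P,\varphi_Q,\theta)$ is a pair $(r,s)$ with $r\colon M\to P$ a morphism of left $H$-modules (for $\phi_M,\phi_P$) and of left $B$-modules (for $\varphi_M,\varphi_P$), $s\colon N\to Q$ a morphism of left $B$-modules, and $s\circ\gamma=\theta\circ r$. These form the category ${}_{(T,\varphi_H)}\mathsf{Mod}$. Diagonal tensor action: for left $X$-modules $(M,\varphi_M)$, $(N,\varphi_N)$, $\varphi_{M\otimes N}=(\varphi_M\otimes\varphi_N)\circ(X\otimes c_{X,M}\otimes N)\circ(\delta_X\otimes M\otimes N)$ (with $X=H$ for $\phi$'s and $X=B$ for $\varphi$'s). The tensor functor acts on morphisms componentwise. *)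

theory Defs
  imports Main
begin

section \<open>Categories, monoidal categories and braidings\<close>

text \<open>
  Hom-sets need not be disjoint: a morphism \<open>f\<close> is always considered together with a hom-set
  \<open>f \<in> Hom C X Y\<close>, and the operations are only constrained on \<open>Ob C\<close> and on such typed morphisms.
  A category given with disjoint hom-sets is a special case; and for modules a morphism can then
  literally be a pair of underlying morphisms, as usual.  Composition is in the applicative order:
  \<open>g \<cdot> f\<close> is \<open>f\<close> followed by \<open>g\<close>.
\<close>

record ('o, 'm) category_data =
  Ob :: "'o set"
  Hom :: "'o \<Rightarrow> 'o \<Rightarrow> 'm set"
  ident :: "'o \<Rightarrow> 'm"  (\<open>ID\<index>\<close>)
  compose :: "'m \<Rightarrow> 'm \<Rightarrow> 'm"  (infixr \<open>\<cdot>\<index>\<close> 55)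

text \<open>
  \<open>\<boxtimes>\<close> is the tensor product of objects, \<open>\<otimes>\<close> that of morphisms.
  \<open>assoc X Y Z : (X \<boxtimes> Y) \<boxtimes> Z \<rightarrow> X \<boxtimes> (Y \<boxtimes> Z)\<close>, \<open>lunit X : \<K> \<boxtimes> X \<rightarrow> X\<close>, \<open>runit X : X \<boxtimes> \<K> \<rightarrow> X\<close>.
\<close>

record ('o, 'm) monoidal_data = "('o, 'm) category_data" +
  tensor_ob :: "'o \<Rightarrow> 'o \<Rightarrow> 'o"  (infixr \<open>\<boxtimes>\<index>\<close> 70)
  tensor_hom :: "'m \<Rightarrow> 'm \<Rightarrow> 'm"  (infixr \<open>\<otimes>\<index>\<close> 70)
  unit_ob :: "'o"  (\<open>\<K>\<index>\<close>)
  assoc :: "'o \<Rightarrow> 'o \<Rightarrow> 'o \<Rightarrow> 'm"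
  lunit :: "'o \<Rightarrow> 'm"
  runit :: "'o \<Rightarrow> 'm"

record ('o, 'm) braided_data = "('o, 'm) monoidal_data" +
  braid :: "'o \<Rightarrow> 'o \<Rightarrow> 'm"

locale category =
  fixes C :: "('o, 'm, 'z) category_data_scheme" (structure)
  assumes ident_hom: "X \<in> Ob C \<Longrightarrow> ID X \<in> Hom C X X"
    and compose_hom: "\<lbrakk>X \<in> Ob C; Y \<in> Ob C; Z \<in> Ob C; f \<in> Hom C X Y; g \<in> Hom C Y Z\<rbrakk>
      \<Longrightarrow> g \<cdot> f \<in> Hom C X Z"
    and ident_left: "\<lbrakk>X \<in> Ob C; Y \<in> Ob C; f \<in> Hom C X Y\<rbrakk> \<Longrightarrow> ID Y \<cdot> f = f"
    and ident_right: "\<lbrakk>X \<in> Ob C; Y \<in> Ob C; f \<in> Hom C X Y\<rbrakk> \<Longrightarrow> f \<cdot> ID X = f"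
    and compose_assoc: "\<lbrakk>W \<in> Ob C; X \<in> Ob C; Y \<in> Ob C; Z \<in> Ob C;
        f \<in> Hom C W X; g \<in> Hom C X Y; h \<in> Hom C Y Z\<rbrakk>
      \<Longrightarrow> (h \<cdot> g) \<cdot> f = h \<cdot> (g \<cdot> f)"

definition is_inverse :: "('o, 'm, 'z) category_data_scheme \<Rightarrow> 'o \<Rightarrow> 'o \<Rightarrow> 'm \<Rightarrow> 'm \<Rightarrow> bool"
  where "is_inverse C X Y f g \<longleftrightarrow>
    f \<in> Hom C X Y \<and> g \<in> Hom C Y X \<and> g \<cdot> f = ID X \<and> f \<cdot> g = ID Y" for C (structure)

definition is_iso :: "('o, 'm, 'z) category_data_scheme \<Rightarrow> 'o \<Rightarrow> 'o \<Rightarrow> 'm \<Rightarrow> bool"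
  where "is_iso C X Y f \<longleftrightarrow> (\<exists>g. is_inverse C X Y f g)"

definition inverse_hom :: "('o, 'm, 'z) category_data_scheme \<Rightarrow> 'o \<Rightarrow> 'o \<Rightarrow> 'm \<Rightarrow> 'm"
  where "inverse_hom C X Y f = (THE g. is_inverse C X Y f g)"

locale monoidal_category = category C
  for C :: "('o, 'm, 'z) monoidal_data_scheme" (structure) +
  assumes unit_ob: "\<K> \<in> Ob C"
    and tensor_ob: "\<lbrakk>X \<in> Ob C; Y \<in> Ob C\<rbrakk> \<Longrightarrow> X \<boxtimes> Y \<in> Ob C"
    and tensor_hom: "\<lbrakk>X \<in> Ob C; X' \<in> Ob C; Y \<in> Ob C; Y' \<in> Ob C; f \<in> Hom C X X'; g \<in> Hom C Y Y'\<rbrakk>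
      \<Longrightarrow> f \<otimes> g \<in> Hom C (X \<boxtimes> Y) (X' \<boxtimes> Y')"
    and tensor_ident: "\<lbrakk>X \<in> Ob C; Y \<in> Ob C\<rbrakk> \<Longrightarrow> ID X \<otimes> ID Y = ID (X \<boxtimes> Y)"
    and tensor_compose: "\<lbrakk>X \<in> Ob C; X' \<in> Ob C; X'' \<in> Ob C; Y \<in> Ob C; Y' \<in> Ob C; Y'' \<in> Ob C;
        f \<in> Hom C X X'; f' \<in> Hom C X' X''; g \<in> Hom C Y Y'; g' \<in> Hom C Y' Y''\<rbrakk>
      \<Longrightarrow> (f' \<cdot> f) \<otimes> (g' \<cdot> g) = (f' \<otimes> g') \<cdot> (f \<otimes> g)"
    and assoc_iso: "\<lbrakk>X \<in> Ob C; Y \<in> Ob C; Z \<in> Ob C\<rbrakk>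
      \<Longrightarrow> is_iso C ((X \<boxtimes> Y) \<boxtimes> Z) (X \<boxtimes> (Y \<boxtimes> Z)) (assoc C X Y Z)"
    and assoc_natural: "\<lbrakk>X \<in> Ob C; X' \<in> Ob C; Y \<in> Ob C; Y' \<in> Ob C; Z \<in> Ob C; Z' \<in> Ob C;
        f \<in> Hom C X X'; g \<in> Hom C Y Y'; h \<in> Hom C Z Z'\<rbrakk>
      \<Longrightarrow> assoc C X' Y' Z' \<cdot> ((f \<otimes> g) \<otimes> h) = (f \<otimes> (g \<otimes> h)) \<cdot> assoc C X Y Z"
    and lunit_iso: "X \<in> Ob C \<Longrightarrow> is_iso C (\<K> \<boxtimes> X) X (lunit C X)"
    and lunit_natural: "\<lbrakk>X \<in> Ob C; X' \<in> Ob C; f \<in> Hom C X X'\<rbrakk>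
      \<Longrightarrow> lunit C X' \<cdot> (ID \<K> \<otimes> f) = f \<cdot> lunit C X"
    and runit_iso: "X \<in> Ob C \<Longrightarrow> is_iso C (X \<boxtimes> \<K>) X (runit C X)"
    and runit_natural: "\<lbrakk>X \<in> Ob C; X' \<in> Ob C; f \<in> Hom C X X'\<rbrakk>
      \<Longrightarrow> runit C X' \<cdot> (f \<otimes> ID \<K>) = f \<cdot> runit C X"
    and pentagon: "\<lbrakk>W \<in> Ob C; X \<in> Ob C; Y \<in> Ob C; Z \<in> Ob C\<rbrakk>
      \<Longrightarrow> assoc C W X (Y \<boxtimes> Z) \<cdot> assoc C (W \<boxtimes> X) Y Z =
          (ID W \<otimes> assoc C X Y Z) \<cdot> assoc C W (X \<boxtimes> Y) Z \<cdot> (assoc C W X Y \<otimes> ID Z)"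
    and triangle: "\<lbrakk>X \<in> Ob C; Y \<in> Ob C\<rbrakk>
      \<Longrightarrow> (ID X \<otimes> lunit C Y) \<cdot> assoc C X \<K> Y = runit C X \<otimes> ID Y"

locale strict_monoidal_category = monoidal_category +
  assumes strict_assoc_ob: "\<lbrakk>X \<in> Ob C; Y \<in> Ob C; Z \<in> Ob C\<rbrakk> \<Longrightarrow> (X \<boxtimes> Y) \<boxtimes> Z = X \<boxtimes> (Y \<boxtimes> Z)"
    and strict_lunit_ob: "X \<in> Ob C \<Longrightarrow> \<K> \<boxtimes> X = X"
    and strict_runit_ob: "X \<in> Ob C \<Longrightarrow> X \<boxtimes> \<K> = X"
    and strict_assoc: "\<lbrakk>X \<in> Ob C; Y \<in> Ob C; Z \<in> Ob C\<rbrakk> \<Longrightarrow> assoc C X Y Z = ID (X \<boxtimes> (Y \<boxtimes> Z))"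
    and strict_lunit: "X \<in> Ob C \<Longrightarrow> lunit C X = ID X"
    and strict_runit: "X \<in> Ob C \<Longrightarrow> runit C X = ID X"

locale braided_monoidal_category = monoidal_category C
  for C :: "('o, 'm, 'z) braided_data_scheme" (structure) +
  assumes braid_iso: "\<lbrakk>X \<in> Ob C; Y \<in> Ob C\<rbrakk> \<Longrightarrow> is_iso C (X \<boxtimes> Y) (Y \<boxtimes> X) (braid C X Y)"
    and braid_natural: "\<lbrakk>X \<in> Ob C; X' \<in> Ob C; Y \<in> Ob C; Y' \<in> Ob C; f \<in> Hom C X X'; g \<in> Hom C Y Y'\<rbrakk>
      \<Longrightarrow> braid C X' Y' \<cdot> (f \<otimes> g) = (g \<otimes> f) \<cdot> braid C X Y"
    and hexagon: "\<lbrakk>X \<in> Ob C; Y \<in> Ob C; Z \<in> Ob C\<rbrakk>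
      \<Longrightarrow> assoc C Y Z X \<cdot> braid C X (Y \<boxtimes> Z) \<cdot> assoc C X Y Z =
          (ID Y \<otimes> braid C X Z) \<cdot> assoc C Y X Z \<cdot> (braid C X Y \<otimes> ID Z)"
    and hexagon_inverse: "\<lbrakk>X \<in> Ob C; Y \<in> Ob C; Z \<in> Ob C\<rbrakk>
      \<Longrightarrow> inverse_hom C ((Z \<boxtimes> X) \<boxtimes> Y) (Z \<boxtimes> (X \<boxtimes> Y)) (assoc C Z X Y) \<cdot> braid C (X \<boxtimes> Y) Z \<cdot>
            inverse_hom C ((X \<boxtimes> Y) \<boxtimes> Z) (X \<boxtimes> (Y \<boxtimes> Z)) (assoc C X Y Z) =
          (braid C X Z \<otimes> ID Y) \<cdot>
            inverse_hom C ((X \<boxtimes> Z) \<boxtimes> Y) (X \<boxtimes> (Z \<boxtimes> Y)) (assoc C X Z Y) \<cdot>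
            (ID X \<otimes> braid C Y Z)"

locale symmetric_monoidal_category = braided_monoidal_category +
  assumes braid_symmetric: "\<lbrakk>X \<in> Ob C; Y \<in> Ob C\<rbrakk> \<Longrightarrow> braid C Y X \<cdot> braid C X Y = ID (X \<boxtimes> Y)"


section \<open>Algebras, coalgebras and Hopf algebras\<close>

text \<open>
  From here on \<open>C\<close> is meant to be strict: the equations below omit associators and unitors and
  identify \<open>X \<boxtimes> \<K>\<close> and \<open>\<K> \<boxtimes> X\<close> with \<open>X\<close>.
\<close>

definition is_algebra :: "('o, 'm, 'z) monoidal_data_scheme \<Rightarrow> 'o \<Rightarrow> 'm \<Rightarrow> 'm \<Rightarrow> bool"
  where "is_algebra C A u m \<longleftrightarrow>
    A \<in> Ob C \<and> u \<in> Hom C \<K> A \<and> m \<in> Hom C (A \<boxtimes> A) A \<and>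
    m \<cdot> (u \<otimes> ID A) = ID A \<and>
    m \<cdot> (ID A \<otimes> u) = ID A \<and>
    m \<cdot> (m \<otimes> ID A) = m \<cdot> (ID A \<otimes> m)" for C (structure)

definition is_coalgebra :: "('o, 'm, 'z) monoidal_data_scheme \<Rightarrow> 'o \<Rightarrow> 'm \<Rightarrow> 'm \<Rightarrow> bool"
  where "is_coalgebra C D e d \<longleftrightarrow>
    D \<in> Ob C \<and> e \<in> Hom C D \<K> \<and> d \<in> Hom C D (D \<boxtimes> D) \<and>
    (e \<otimes> ID D) \<cdot> d = ID D \<and>
    (ID D \<otimes> e) \<cdot> d = ID D \<and>
    (d \<otimes> ID D) \<cdot> d = (ID D \<otimes> d) \<cdot> d" for C (structure)

definition algebra_morphism ::
  "('o, 'm, 'z) monoidal_data_scheme \<Rightarrow> 'o \<Rightarrow> 'm \<Rightarrow> 'm \<Rightarrow> 'o \<Rightarrow> 'm \<Rightarrow> 'm \<Rightarrow> 'm \<Rightarrow> bool"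
  where "algebra_morphism C A u m A' u' m' f \<longleftrightarrow>
    f \<in> Hom C A A' \<and> f \<cdot> u = u' \<and> f \<cdot> m = m' \<cdot> (f \<otimes> f)" for C (structure)

definition coalgebra_morphism ::
  "('o, 'm, 'z) monoidal_data_scheme \<Rightarrow> 'o \<Rightarrow> 'm \<Rightarrow> 'm \<Rightarrow> 'o \<Rightarrow> 'm \<Rightarrow> 'm \<Rightarrow> 'm \<Rightarrow> bool"
  where "coalgebra_morphism C D e d D' e' d' f \<longleftrightarrow>
    f \<in> Hom C D D' \<and> e' \<cdot> f = e \<and> d' \<cdot> f = (f \<otimes> f) \<cdot> d" for C (structure)

definition tensor_mult :: "('o, 'm, 'z) braided_data_scheme \<Rightarrow> 'o \<Rightarrow> 'm \<Rightarrow> 'o \<Rightarrow> 'm \<Rightarrow> 'm"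
  where "tensor_mult C A m A' m' = (m \<otimes> m') \<cdot> (ID A \<otimes> braid C A' A \<otimes> ID A')" for C (structure)

definition tensor_comult :: "('o, 'm, 'z) braided_data_scheme \<Rightarrow> 'o \<Rightarrow> 'm \<Rightarrow> 'o \<Rightarrow> 'm \<Rightarrow> 'm"
  where "tensor_comult C D d D' d' = (ID D \<otimes> braid C D D' \<otimes> ID D') \<cdot> (d \<otimes> d')" for C (structure)

record ('o, 'm) alg_coalg =
  obj :: 'o
  \<eta> :: 'm
  \<mu> :: 'm
  \<epsilon> :: 'm
  \<delta> :: 'm

record ('o, 'm) hopf = "('o, 'm) alg_coalg" +
  antipode :: 'm

definition algebra_coalgebra ::
  "('o, 'm, 'z) monoidal_data_scheme \<Rightarrow> ('o, 'm, 'y) alg_coalg_scheme \<Rightarrow> bool"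
  where "algebra_coalgebra C X \<longleftrightarrow>
    is_algebra C (obj X) (\<eta> X) (\<mu> X) \<and> is_coalgebra C (obj X) (\<epsilon> X) (\<delta> X)"

text \<open>The unit object is an algebra with unit and product \<open>ID \<K>\<close> (using \<open>\<K> \<boxtimes> \<K> = \<K>\<close>).\<close>

definition hopf_algebra :: "('o, 'm, 'z) braided_data_scheme \<Rightarrow> ('o, 'm) hopf \<Rightarrow> bool"
  where "hopf_algebra C X \<longleftrightarrow>
    algebra_coalgebra C X \<and>
    algebra_morphism C (obj X) (\<eta> X) (\<mu> X) \<K> (ID \<K>) (ID \<K>) (\<epsilon> X) \<and>
    algebra_morphism C (obj X) (\<eta> X) (\<mu> X)
      (obj X \<boxtimes> obj X) (\<eta> X \<otimes> \<eta> X) (tensor_mult C (obj X) (\<mu> X) (obj X) (\<mu> X)) (\<delta> X) \<and>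
    antipode X \<in> Hom C (obj X) (obj X) \<and>
    \<mu> X \<cdot> (antipode X \<otimes> ID (obj X)) \<cdot> \<delta> X = \<eta> X \<cdot> \<epsilon> X \<and>
    \<mu> X \<cdot> (ID (obj X) \<otimes> antipode X) \<cdot> \<delta> X = \<eta> X \<cdot> \<epsilon> X" for C (structure)

definition cocommutative :: "('o, 'm, 'z) braided_data_scheme \<Rightarrow> ('o, 'm, 'y) alg_coalg_scheme \<Rightarrow> bool"
  where "cocommutative C X \<longleftrightarrow> braid C (obj X) (obj X) \<cdot> \<delta> X = \<delta> X" for C (structure)


section \<open>Modules and relative Rota-Baxter operators\<close>

definition left_module ::
  "('o, 'm, 'z) monoidal_data_scheme \<Rightarrow> ('o, 'm, 'y) alg_coalg_scheme \<Rightarrow> 'o \<Rightarrow> 'm \<Rightarrow> bool"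
  where "left_module C X M a \<longleftrightarrow>
    M \<in> Ob C \<and> a \<in> Hom C (obj X \<boxtimes> M) M \<and>
    a \<cdot> (\<eta> X \<otimes> ID M) = ID M \<and>
    a \<cdot> (ID (obj X) \<otimes> a) = a \<cdot> (\<mu> X \<otimes> ID M)" for C (structure)

definition module_morphism ::
  "('o, 'm, 'z) monoidal_data_scheme \<Rightarrow> ('o, 'm, 'y) alg_coalg_scheme
    \<Rightarrow> 'o \<Rightarrow> 'm \<Rightarrow> 'o \<Rightarrow> 'm \<Rightarrow> 'm \<Rightarrow> bool"
  where "module_morphism C X M a M' a' f \<longleftrightarrow>
    f \<in> Hom C M M' \<and> f \<cdot> a = a' \<cdot> (ID (obj X) \<otimes> f)" for C (structure)

definition diagonal_action ::
  "('o, 'm, 'z) braided_data_scheme \<Rightarrow> ('o, 'm, 'y) alg_coalg_scheme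
    \<Rightarrow> 'o \<Rightarrow> 'm \<Rightarrow> 'o \<Rightarrow> 'm \<Rightarrow> 'm"
  where "diagonal_action C X M a M' a' =
    (a \<otimes> a') \<cdot> (ID (obj X) \<otimes> braid C (obj X) M \<otimes> ID M') \<cdot> (\<delta> X \<otimes> ID M \<otimes> ID M')"
    for C (structure)

definition module_algebra_coalgebra ::
  "('o, 'm, 'z) braided_data_scheme \<Rightarrow> ('o, 'm, 'y) alg_coalg_scheme
    \<Rightarrow> ('o, 'm, 'x) alg_coalg_scheme \<Rightarrow> 'm \<Rightarrow> bool"
  where "module_algebra_coalgebra C X A a \<longleftrightarrow>
    left_module C X (obj A) a \<and>
    a \<cdot> (ID (obj X) \<otimes> \<eta> A) = \<epsilon> X \<otimes> \<eta> A \<and>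
    a \<cdot> (ID (obj X) \<otimes> \<mu> A) =
      \<mu> A \<cdot> (a \<otimes> a) \<cdot> (ID (obj X) \<otimes> braid C (obj X) (obj A) \<otimes> ID (obj A)) \<cdot>
        (\<delta> X \<otimes> ID (obj A) \<otimes> ID (obj A)) \<and>
    coalgebra_morphism C
      (obj X \<boxtimes> obj A) (\<epsilon> X \<otimes> \<epsilon> A) (tensor_comult C (obj X) (\<delta> X) (obj A) (\<delta> A))
      (obj A) (\<epsilon> A) (\<delta> A) a" for C (structure)

definition relative_rota_baxter ::
  "('o, 'm, 'z) braided_data_scheme \<Rightarrow> ('o, 'm) hopf \<Rightarrow> ('o, 'm) hopf \<Rightarrow> 'm \<Rightarrow> 'm \<Rightarrow> bool"
  where "relative_rota_baxter C H B T a \<longleftrightarrow>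
    hopf_algebra C H \<and> hopf_algebra C B \<and>
    module_algebra_coalgebra C B H a \<and>
    coalgebra_morphism C (obj H) (\<epsilon> H) (\<delta> H) (obj B) (\<epsilon> B) (\<delta> B) T \<and>
    \<mu> B \<cdot> (T \<otimes> T) =
      T \<cdot> \<mu> H \<cdot> (ID (obj H) \<otimes> (a \<cdot> (T \<otimes> ID (obj H)))) \<cdot> (\<delta> H \<otimes> ID (obj H))"
    for C (structure)


section \<open>Modules over a relative Rota-Baxter operator\<close>

text \<open>
  In a tuple \<open>(M, N, hM, bM, bN, g)\<close>, \<open>hM\<close> is the action of \<open>H\<close> on \<open>M\<close>, while \<open>bM\<close> and \<open>bN\<close> are
  the actions of \<open>B\<close> on \<open>M\<close> and \<open>N\<close>.
\<close>

type_synonym ('o, 'm) rb_module = "'o \<times> 'o \<times> 'm \<times> 'm \<times> 'm \<times> 'm"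

definition is_rb_module ::
  "('o, 'm, 'z) braided_data_scheme \<Rightarrow> ('o, 'm) hopf \<Rightarrow> ('o, 'm) hopf \<Rightarrow> 'm \<Rightarrow> 'm
    \<Rightarrow> ('o, 'm) rb_module \<Rightarrow> bool"
  where "is_rb_module C H B T a = (\<lambda>(M, N, hM, bM, bN, g).
    left_module C H M hM \<and> left_module C B M bM \<and>
    bM \<cdot> (ID (obj B) \<otimes> hM) =
      hM \<cdot> (a \<otimes> bM) \<cdot> (ID (obj B) \<otimes> braid C (obj B) (obj H) \<otimes> ID M) \<cdot>
        (\<delta> B \<otimes> ID (obj H) \<otimes> ID M) \<and>
    left_module C B N bN \<and>
    g \<in> Hom C M N \<and>
    bN \<cdot> (T \<otimes> g) =
      g \<cdot> hM \<cdot> (ID (obj H) \<otimes> (bM \<cdot> (T \<otimes> ID M))) \<cdot> (\<delta> H \<otimes> ID M))" for C (structure)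

definition rb_module_hom ::
  "('o, 'm, 'z) braided_data_scheme \<Rightarrow> ('o, 'm) hopf \<Rightarrow> ('o, 'm) hopf
    \<Rightarrow> ('o, 'm) rb_module \<Rightarrow> ('o, 'm) rb_module \<Rightarrow> ('m \<times> 'm) set"
  where "rb_module_hom C H B = (\<lambda>(M, N, hM, bM, bN, g) (P, Q, hP, bP, bQ, t).
    {(r, s). module_morphism C H M hM P hP r \<and> module_morphism C B M bM P bP r \<and>
             module_morphism C B N bN Q bQ s \<and> s \<cdot> g = t \<cdot> r})" for C (structure)

definition rb_module_tensor ::
  "('o, 'm, 'z) braided_data_scheme \<Rightarrow> ('o, 'm) hopf \<Rightarrow> ('o, 'm) hopf
    \<Rightarrow> ('o, 'm) rb_module \<Rightarrow> ('o, 'm) rb_module \<Rightarrow> ('o, 'm) rb_module"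
  where "rb_module_tensor C H B = (\<lambda>(M, N, hM, bM, bN, g) (P, Q, hP, bP, bQ, t).
    (M \<boxtimes> P, N \<boxtimes> Q,
     diagonal_action C H M hM P hP,
     diagonal_action C B M bM P bP,
     diagonal_action C B N bN Q bQ,
     g \<otimes> t))" for C (structure)

text \<open>
  The category of modules over \<open>(T : H \<rightarrow> B, a)\<close> with its proposed symmetric monoidal structure.
  The associativity and unit constraints are those of \<open>C\<close> in each component, so they are
  identities when \<open>C\<close> is strict.
\<close>

definition rb_Mod ::
  "('o, 'm, 'z) braided_data_scheme \<Rightarrow> ('o, 'm) hopf \<Rightarrow> ('o, 'm) hopf \<Rightarrow> 'm \<Rightarrow> 'm
    \<Rightarrow> (('o, 'm) rb_module, 'm \<times> 'm) braided_data"
  where "rb_Mod C H B T a = \<lparr>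
    Ob = {X. is_rb_module C H B T a X},
    Hom = rb_module_hom C H B,
    ident = (\<lambda>(M, N, _). (ID M, ID N)),
    compose = (\<lambda>(r', s') (r, s). (r' \<cdot> r, s' \<cdot> s)),
    tensor_ob = rb_module_tensor C H B,
    tensor_hom = (\<lambda>(r, s) (r', s'). (r \<otimes> r', s \<otimes> s')),
    unit_ob = (\<K>, \<K>, \<epsilon> H, \<epsilon> B, \<epsilon> B, ID \<K>),
    assoc = (\<lambda>(M, N, _) (P, Q, _) (R, S, _). (assoc C M P R, assoc C N Q S)),
    lunit = (\<lambda>(M, N, _). (lunit C M, lunit C N)),
    runit = (\<lambda>(M, N, _). (runit C M, runit C N)),
    braid = (\<lambda>(M, N, _) (P, Q, _). (braid C M P, braid C N Q))\<rparr>" for C (structure)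

end

theory Submission
  imports Defs
begin

text \<open>
  For objects \<open>D\<close>, \<open>M\<close>, \<open>P\<close> and a map \<open>d : D \<rightarrow> D \<boxtimes> D\<close>, maps \<open>x : D \<boxtimes> M \<rightarrow> M'\<close> and
  \<open>y : D \<boxtimes> P \<rightarrow> P'\<close> have a diagonal tensor product \<open>diag x y : D \<boxtimes> M \<boxtimes> P \<rightarrow> M' \<boxtimes> P'\<close>.  It is
  compatible with pulling back along comultiplicative maps \<open>D' \<rightarrow> D\<close>, and it turns the composite
  \<open>x' (E \<otimes> x) : E \<boxtimes> D \<boxtimes> M \<rightarrow> M''\<close> of two such maps into the composite of the diagonal products,
  taken over the tensor coalgebra \<open>E \<boxtimes> D\<close>.

  Every condition on a module over \<open>T\<close> says that one composite of actions is the pullback of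
  another: associativity is \<open>x (X \<otimes> x) = \<mu>* x\<close>; the compatibility of the two actions on \<open>M\<close> is
  \<open>x (B \<otimes> z) = k* (z (H \<otimes> x))\<close> with \<open>k = (\<phi>\<^sub>H \<otimes> B) (B \<otimes> c) (\<delta>\<^sub>B \<otimes> H)\<close>; and condition (iii) is
  \<open>(T \<otimes> g)* n = g \<delta>\<^sub>H* (z (H \<otimes> T* x))\<close>.  Since the comultiplication of a cocommutative coalgebra is
  comultiplicative, so are \<open>k\<close> and \<open>\<delta>\<^sub>H\<close>, and all conditions pass to diagonal products.
\<close>

section \<open>Strict symmetric monoidal categories\<close>

text \<open>
  Hom-sets may overlap, so a bare morphism does not determine its source and target.  Recording
  both makes the typing side conditions below decidable by rewriting.
\<close>

datatype ('o, 'm) arrow = Arrow (dm: 'o) (mor: 'm) (cd: 'o)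

locale strict_symmetric_category = strict_monoidal_category C + symmetric_monoidal_category C
  for C :: "('o, 'm, 'z) braided_data_scheme" (structure)
begin

section \<open>Typed arrows with composition, tensor product, identities and braiding\<close>

definition arr :: "('o, 'm) arrow \<Rightarrow> bool"
  where "arr F \<longleftrightarrow> dm F \<in> Ob C \<and> cd F \<in> Ob C \<and> mor F \<in> Hom C (dm F) (cd F)"

text \<open>The outer endpoints are taken from the factors without a composability test; agreement
  of the middle objects is a hypothesis of the laws, discharged by rewriting.\<close>

definition cmp :: "('o, 'm) arrow \<Rightarrow> ('o, 'm) arrow \<Rightarrow> ('o, 'm) arrow"  (infixr \<open>\<bullet>\<close> 55)
  where "F \<bullet> G = Arrow (dm G) (mor F \<cdot> mor G) (cd F)"

definition tns :: "('o, 'm) arrow \<Rightarrow> ('o, 'm) arrow \<Rightarrow> ('o, 'm) arrow"  (infixr \<open>\<odot>\<close> 70)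
  where "F \<odot> G = Arrow (dm F \<boxtimes> dm G) (mor F \<otimes> mor G) (cd F \<boxtimes> cd G)"

definition idt :: "'o \<Rightarrow> ('o, 'm) arrow"
  where "idt X = Arrow X (ID X) X"

definition brd :: "'o \<Rightarrow> 'o \<Rightarrow> ('o, 'm) arrow"
  where "brd X Y = Arrow (X \<boxtimes> Y) (braid C X Y) (Y \<boxtimes> X)"

declare unit_ob [simp] tensor_ob [simp] strict_assoc_ob [simp] strict_lunit_ob [simp]
  strict_runit_ob [simp]

lemma braid_hom: "\<lbrakk>X \<in> Ob C; Y \<in> Ob C\<rbrakk> \<Longrightarrow> braid C X Y \<in> Hom C (X \<boxtimes> Y) (Y \<boxtimes> X)"
  using braid_iso by (auto simp: is_iso_def is_inverse_def)

lemma projections [simp]: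
  "dm (F \<bullet> G) = dm G" "cd (F \<bullet> G) = cd F" "mor (F \<bullet> G) = mor F \<cdot> mor G"
  "dm (F \<odot> G) = dm F \<boxtimes> dm G" "cd (F \<odot> G) = cd F \<boxtimes> cd G" "mor (F \<odot> G) = mor F \<otimes> mor G"
  "dm (idt X) = X" "cd (idt X) = X" "mor (idt X) = ID X"
  "dm (brd X Y) = X \<boxtimes> Y" "cd (brd X Y) = Y \<boxtimes> X" "mor (brd X Y) = braid C X Y"
  by (simp_all add: cmp_def tns_def idt_def brd_def)

lemma arr_Ob: "arr F \<Longrightarrow> dm F \<in> Ob C" "arr F \<Longrightarrow> cd F \<in> Ob C"
  by (simp_all add: arr_def)

lemma arr_intros:
  "\<lbrakk>arr F; arr G; cd G = dm F\<rbrakk> \<Longrightarrow> arr (F \<bullet> G)"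
  "\<lbrakk>arr F; arr G\<rbrakk> \<Longrightarrow> arr (F \<odot> G)"
  "X \<in> Ob C \<Longrightarrow> arr (idt X)"
  "\<lbrakk>X \<in> Ob C; Y \<in> Ob C\<rbrakk> \<Longrightarrow> arr (brd X Y)"
  by (simp_all add: arr_def compose_hom[of "dm G" "dm F" "cd F"] tensor_hom ident_hom braid_hom)

lemma cmp_idt [simp]:
  "\<lbrakk>arr F; cd F = X\<rbrakk> \<Longrightarrow> idt X \<bullet> F = F"
  "\<lbrakk>arr F; dm F = X\<rbrakk> \<Longrightarrow> F \<bullet> idt X = F"
  by (auto simp: arr_def intro!: arrow.expand ident_left ident_right)

lemma cmp_assoc [simp]:
  "\<lbrakk>arr F; arr G; arr K; cd G = dm F; cd K = dm G\<rbrakk> \<Longrightarrow> (F \<bullet> G) \<bullet> K = F \<bullet> (G \<bullet> K)"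
  by (auto simp: arr_def intro!: arrow.expand compose_assoc)

lemma tns_idt: "\<lbrakk>X \<in> Ob C; Y \<in> Ob C\<rbrakk> \<Longrightarrow> idt (X \<boxtimes> Y) = idt X \<odot> idt Y"
  by (auto intro!: arrow.expand simp: tensor_ident)

lemma tns_cmp:
  "\<lbrakk>arr F; arr F'; arr G; arr G'; cd F' = dm F; cd G' = dm G\<rbrakk>
    \<Longrightarrow> (F \<odot> G) \<bullet> (F' \<odot> G') = (F \<bullet> F') \<odot> (G \<bullet> G')"
  using tensor_compose[of "dm F'" "dm F" "cd F" "dm G'" "dm G" "cd G" "mor F'" "mor F" "mor G'" "mor G"]
  by (simp add: arr_def arrow.expand)

lemma brd_natural:
  "\<lbrakk>arr F; arr G\<rbrakk> \<Longrightarrow> brd (cd F) (cd G) \<bullet> (F \<odot> G) = (G \<odot> F) \<bullet> brd (dm F) (dm G)"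
  by (simp add: arr_def arrow.expand braid_natural[of "dm F" "cd F" "dm G" "cd G"])

declare arr_Ob [simp] arr_intros [simp]

text \<open>\<open>cmp_assoc\<close> nests composites to the right, so adjacent tensor products
  often occur with a tail \<open>K\<close>, which the interchange law must see past.\<close>

lemma tns_cmp_cmp:
  "\<lbrakk>arr F; arr F'; arr G; arr G'; cd F' = dm F; cd G' = dm G; arr K; cd K = dm F' \<boxtimes> dm G'\<rbrakk>
    \<Longrightarrow> (F \<odot> G) \<bullet> (F' \<odot> G') \<bullet> K = ((F \<bullet> F') \<odot> (G \<bullet> G')) \<bullet> K"
  by (subst tns_cmp[symmetric]) simp_all

text \<open>Equality of objects alone does not identify the two bracketings of morphisms. Naturality
  of the associator does, once associators are identities.\<close>

lemma tns_assoc [simp]: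
  assumes "arr F" "arr G" "arr K"
  shows "(F \<odot> G) \<odot> K = F \<odot> (G \<odot> K)"
proof (rule arrow.expand, safe)
  \<comment> \<open>Both bracketings are typed because the identity laws cancel \<open>ID\<close>
    only on a morphism with known endpoints.\<close>
  have "(mor F \<otimes> mor G) \<otimes> mor K \<in> Hom C (dm F \<boxtimes> dm G \<boxtimes> dm K) (cd F \<boxtimes> cd G \<boxtimes> cd K)"
    "mor F \<otimes> mor G \<otimes> mor K \<in> Hom C (dm F \<boxtimes> dm G \<boxtimes> dm K) (cd F \<boxtimes> cd G \<boxtimes> cd K)"
    using assms arr_intros(2)[OF arr_intros(2)[of F G], of K] arr_intros(2)[OF _ arr_intros(2)[of G K], of F]
    by (simp_all add: arr_def del: arr_Ob)
  with assms assoc_natural[of "dm F" "cd F" "dm G" "cd G" "dm K" "cd K" "mor F" "mor G" "mor K"]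
  show "mor ((F \<odot> G) \<odot> K) = mor (F \<odot> (G \<odot> K))"
    by (simp del: arr_Ob add: arr_def strict_assoc ident_left[of "dm F \<boxtimes> dm G \<boxtimes> dm K" "cd F \<boxtimes> cd G \<boxtimes> cd K"]
       ident_right[of "dm F \<boxtimes> dm G \<boxtimes> dm K" "cd F \<boxtimes> cd G \<boxtimes> cd K"])
qed (use assms in simp_all)

text \<open>Naturality of the unitors, which strictness turns into identities.\<close>

lemma tns_unit [simp]:
  assumes "arr F" shows "idt \<K> \<odot> F = F" and "F \<odot> idt \<K> = F"
proof -
  have "ID \<K> \<otimes> mor F \<in> Hom C (dm F) (cd F)" "mor F \<otimes> ID \<K> \<in> Hom C (dm F) (cd F)"
    using assms arr_intros(2)[of "idt \<K>" F] arr_intros(2)[of F "idt \<K>"] by (simp_all add: arr_def ident_hom del: arr_Ob)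
  with assms lunit_natural[of "dm F" "cd F" "mor F"] runit_natural[of "dm F" "cd F" "mor F"]
  show "idt \<K> \<odot> F = F" "F \<odot> idt \<K> = F"
    by (auto simp del: arr_Ob simp: arr_def strict_lunit strict_runit ident_left[of "dm F" "cd F"]
          ident_right[of "dm F" "cd F"] intro!: arrow.expand)
qed

text \<open>Rewriting with \<open>tns_idt\<close> splits the identity of a tensor product into a
  form that \<open>cmp_idt\<close> does not recognise; these rules cancel it.\<close>

lemma cmp_idt_tns [simp]:
  "\<lbrakk>arr F; X \<in> Ob C; Y \<in> Ob C; dm F = X \<boxtimes> Y\<rbrakk> \<Longrightarrow> F \<bullet> (idt X \<odot> idt Y) = F"
  "\<lbrakk>arr F; X \<in> Ob C; Y \<in> Ob C; cd F = X \<boxtimes> Y\<rbrakk> \<Longrightarrow> (idt X \<odot> idt Y) \<bullet> F = F"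
  "\<lbrakk>arr F; X \<in> Ob C; Y \<in> Ob C; Z \<in> Ob C; dm F = X \<boxtimes> Y \<boxtimes> Z\<rbrakk>
    \<Longrightarrow> F \<bullet> (idt X \<odot> idt Y \<odot> idt Z) = F"
  "\<lbrakk>arr F; X \<in> Ob C; Y \<in> Ob C; Z \<in> Ob C; cd F = X \<boxtimes> Y \<boxtimes> Z\<rbrakk>
    \<Longrightarrow> (idt X \<odot> idt Y \<odot> idt Z) \<bullet> F = F"
  by (simp_all flip: tns_idt)

lemma whisker:
  "\<lbrakk>arr F; arr G; cd G = dm F; X \<in> Ob C\<rbrakk> \<Longrightarrow> idt X \<odot> (F \<bullet> G) = (idt X \<odot> F) \<bullet> (idt X \<odot> G)"
  "\<lbrakk>arr F; arr G; cd G = dm F; X \<in> Ob C\<rbrakk> \<Longrightarrow> (F \<bullet> G) \<odot> idt X = (F \<odot> idt X) \<bullet> (G \<odot> idt X)"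
  by (simp_all add: tns_cmp)

section \<open>Symmetry, hexagons and unit law of the braiding in strict form\<close>

lemma brd_sym: "\<lbrakk>X \<in> Ob C; Y \<in> Ob C\<rbrakk> \<Longrightarrow> brd Y X \<bullet> brd X Y = idt X \<odot> idt Y"
  by (auto intro!: arrow.expand simp: braid_symmetric tensor_ident)

lemma brd_hexagon:
  assumes "X \<in> Ob C" "Y \<in> Ob C" "Z \<in> Ob C"
  shows "brd X (Y \<boxtimes> Z) = (idt Y \<odot> brd X Z) \<bullet> (brd X Y \<odot> idt Z)"
proof -
  \<comment> \<open>Identities stand where \<open>hexagon\<close> has associators;
    \<open>cmp_idt\<close> is disabled so that they survive until the match.\<close>
  have "idt (Y \<boxtimes> Z \<boxtimes> X) \<bullet> brd X (Y \<boxtimes> Z) \<bullet> idt (X \<boxtimes> Y \<boxtimes> Z) =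
      (idt Y \<odot> brd X Z) \<bullet> idt (Y \<boxtimes> X \<boxtimes> Z) \<bullet> (brd X Y \<odot> idt Z)"
    using assms hexagon[of X Y Z]
    by (auto intro!: arrow.expand simp: strict_assoc simp del: cmp_idt)
  with assms show ?thesis by simp
qed

text \<open>By the first hexagon, \<open>?R\<close> is \<open>brd Z (X \<boxtimes> Y)\<close>.
  \<open>?L\<close> is a left inverse of it and, by symmetry, the left side is a right inverse, so
  the two agree.\<close>

lemma brd_hexagon':
  assumes "X \<in> Ob C" "Y \<in> Ob C" "Z \<in> Ob C"
  shows "brd (X \<boxtimes> Y) Z = (brd X Z \<odot> idt Y) \<bullet> (idt X \<odot> brd Y Z)"
proof -
  let ?L = "(brd X Z \<odot> idt Y) \<bullet> (idt X \<odot> brd Y Z)"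
  let ?R = "(idt X \<odot> brd Z Y) \<bullet> (brd Z X \<odot> idt Y)"
  have *: "?L \<bullet> ?R = idt (Z \<boxtimes> X \<boxtimes> Y)"
    using assms
    by (simp add: tns_cmp_cmp tns_cmp brd_sym) (simp add: tns_idt tns_cmp brd_sym)
  have "brd (X \<boxtimes> Y) Z = (?L \<bullet> ?R) \<bullet> brd (X \<boxtimes> Y) Z"
    using assms by (subst *) simp
  also have "\<dots> = ?L \<bullet> brd Z (X \<boxtimes> Y) \<bullet> brd (X \<boxtimes> Y) Z"
    using assms by (simp add: brd_hexagon)
  also have "\<dots> = ?L"
    using assms by (subst brd_sym) (simp_all flip: tns_idt)
  finally show ?thesis .
qed

text \<open>The hexagon at two copies of the unit makes \<open>brd X \<K>\<close> idempotent, and an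
  invertible idempotent is an identity.\<close>

lemma brd_unit [simp]:
  assumes "X \<in> Ob C" shows "brd X \<K> = idt X"
proof -
  have "brd X \<K> = brd X \<K> \<bullet> brd X \<K>"
    using assms brd_hexagon[of X \<K> \<K>] by simp
  then have "brd \<K> X \<bullet> brd X \<K> = brd \<K> X \<bullet> brd X \<K> \<bullet> brd X \<K>" by simp
  also have "\<dots> = (brd \<K> X \<bullet> brd X \<K>) \<bullet> brd X \<K>" using assms by simp
  finally show ?thesis using assms by (simp add: brd_sym)
qed

lemma slide:
  "\<lbrakk>arr F; arr G\<rbrakk> \<Longrightarrow> (idt (cd F) \<odot> G) \<bullet> (F \<odot> idt (dm G)) = (F \<odot> idt (cd G)) \<bullet> (idt (dm F) \<odot> G)"
  by (simp add: tns_cmp)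

text \<open>The middle-four interchange, the structure map of \<open>\<otimes>\<close> as a monoidal functor.\<close>

definition mid :: "'o \<Rightarrow> 'o \<Rightarrow> 'o \<Rightarrow> 'o \<Rightarrow> ('o, 'm) arrow"
  where "mid X Y Z W = idt X \<odot> brd Y Z \<odot> idt W"

lemma mid_projections [simp]:
  "\<lbrakk>X \<in> Ob C; Y \<in> Ob C; Z \<in> Ob C; W \<in> Ob C\<rbrakk> \<Longrightarrow> dm (mid X Y Z W) = X \<boxtimes> Y \<boxtimes> Z \<boxtimes> W"
  "\<lbrakk>X \<in> Ob C; Y \<in> Ob C; Z \<in> Ob C; W \<in> Ob C\<rbrakk> \<Longrightarrow> cd (mid X Y Z W) = X \<boxtimes> Z \<boxtimes> Y \<boxtimes> W"
  "\<lbrakk>X \<in> Ob C; Y \<in> Ob C; Z \<in> Ob C; W \<in> Ob C\<rbrakk> \<Longrightarrow> arr (mid X Y Z W)"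
  by (simp_all add: mid_def)

lemma mid_natural:
  assumes "arr F" "arr G" "arr K" "arr L"
  shows "mid (cd F) (cd G) (cd K) (cd L) \<bullet> (F \<odot> G \<odot> K \<odot> L) =
    (F \<odot> K \<odot> G \<odot> L) \<bullet> mid (dm F) (dm G) (dm K) (dm L)"
proof -
  \<comment> \<open>The middle pair is bracketed so that naturality of the braiding applies to
    it.\<close>
  have "mid (cd F) (cd G) (cd K) (cd L) \<bullet> (F \<odot> (G \<odot> K) \<odot> L) =
    (F \<odot> (K \<odot> G) \<odot> L) \<bullet> mid (dm F) (dm G) (dm K) (dm L)"
    using assms unfolding mid_def by (simp add: tns_cmp brd_natural del: tns_assoc)
  with assms show ?thesis by simp
qed

text \<open>Both sides rearrange \<open>E F D G M P\<close> into \<open>E D M F G P\<close>. The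
  outer factors \<open>E\<close> and \<open>P\<close> are inert. The crossings of \<open>F\<close>
  with \<open>D\<close> and of \<open>G\<close> with \<open>M\<close> are independent and slide past
  each other; the hexagons regroup the rest.\<close>

lemma mid_assoc:
  assumes [simp]: "E \<in> Ob C" "F \<in> Ob C" "D \<in> Ob C" "G \<in> Ob C" "M \<in> Ob C" "P \<in> Ob C"
  shows "mid (E \<boxtimes> D) (F \<boxtimes> G) M P \<bullet> (mid E F D G \<odot> idt M \<odot> idt P) =
    mid E F (D \<boxtimes> M) (G \<boxtimes> P) \<bullet> (idt E \<odot> idt F \<odot> mid D G M P)"
proof -
  have "(idt D \<odot> brd (F \<boxtimes> G) M) \<bullet> (brd F D \<odot> idt (G \<boxtimes> M)) =
      (idt D \<odot> brd F M \<odot> idt G) \<bullet> (idt (D \<boxtimes> F) \<odot> brd G M) \<bullet> (brd F D \<odot> idt (G \<boxtimes> M))"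
    by (simp add: brd_hexagon' tns_idt tns_cmp_cmp)
  also have "(idt (D \<boxtimes> F) \<odot> brd G M) \<bullet> (brd F D \<odot> idt (G \<boxtimes> M)) =
      (brd F D \<odot> idt (M \<boxtimes> G)) \<bullet> (idt (F \<boxtimes> D) \<odot> brd G M)"
    using slide[of "brd F D" "brd G M"] by simp
  also have "(idt D \<odot> brd F M \<odot> idt G) \<bullet> \<dots> =
     ((idt D \<odot> brd F M) \<odot> idt G) \<bullet> ((brd F D \<odot> idt M) \<odot> idt G) \<bullet> (idt (F \<boxtimes> D) \<odot> brd G M)"
    by (simp add: tns_idt)
  also have "\<dots> = (brd F (D \<boxtimes> M) \<odot> idt G) \<bullet> (idt (F \<boxtimes> D) \<odot> brd G M)"
    by (simp add: brd_hexagon tns_cmp_cmp del: tns_assoc)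
  finally have *: "(idt D \<odot> brd (F \<boxtimes> G) M) \<bullet> (brd F D \<odot> idt (G \<boxtimes> M)) =
     (brd F (D \<boxtimes> M) \<odot> idt G) \<bullet> (idt (F \<boxtimes> D) \<odot> brd G M)" .
  have "mid (E \<boxtimes> D) (F \<boxtimes> G) M P \<bullet> (mid E F D G \<odot> idt M \<odot> idt P) =
     idt E \<odot> ((idt D \<odot> brd (F \<boxtimes> G) M) \<bullet> (brd F D \<odot> idt (G \<boxtimes> M))) \<odot> idt P"
    unfolding mid_def by (simp add: tns_idt whisker)
  also have "\<dots> = mid E F (D \<boxtimes> M) (G \<boxtimes> P) \<bullet> (idt E \<odot> idt F \<odot> mid D G M P)"
    unfolding mid_def * by (simp add: tns_idt whisker)
  finally show ?thesis .
qed

text \<open>Both sides sort \<open>A B D M P R\<close> into the pairs \<open>A M B P D R\<close>, by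
  the same sliding argument. This version serves three tensor factors, whereas
  \<open>mid_assoc\<close> serves composites of actions.\<close>

lemma mid_assoc':
  assumes [simp]: "A \<in> Ob C" "B \<in> Ob C" "D \<in> Ob C" "M \<in> Ob C" "P \<in> Ob C" "R \<in> Ob C"
  shows "(mid A B M P \<odot> idt D \<odot> idt R) \<bullet> mid (A \<boxtimes> B) D (M \<boxtimes> P) R =
    (idt A \<odot> idt M \<odot> mid B D P R) \<bullet> mid A (B \<boxtimes> D) M (P \<boxtimes> R)"
proof -
  have "(brd B M \<odot> idt (P \<boxtimes> D)) \<bullet> (idt B \<odot> brd D (M \<boxtimes> P)) =
      (brd B M \<odot> idt (P \<boxtimes> D)) \<bullet> (idt (B \<boxtimes> M) \<odot> brd D P) \<bullet> (idt B \<odot> brd D M \<odot> idt P)"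
    by (simp add: brd_hexagon tns_idt tns_cmp)
  also have "\<dots> = ((brd B M \<odot> idt (P \<boxtimes> D)) \<bullet> (idt (B \<boxtimes> M) \<odot> brd D P)) \<bullet> (idt B \<odot> brd D M \<odot> idt P)"
    by simp
  also have "(brd B M \<odot> idt (P \<boxtimes> D)) \<bullet> (idt (B \<boxtimes> M) \<odot> brd D P) =
      (idt (M \<boxtimes> B) \<odot> brd D P) \<bullet> (brd B M \<odot> idt (D \<boxtimes> P))"
    using slide[of "brd B M" "brd D P"] by simp
  also have "\<dots> \<bullet> (idt B \<odot> brd D M \<odot> idt P) =
     (idt (M \<boxtimes> B) \<odot> brd D P) \<bullet> ((brd B M \<odot> idt D) \<odot> idt P) \<bullet> ((idt B \<odot> brd D M) \<odot> idt P)"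
    by (simp add: tns_idt)
  also have "\<dots> = (idt (M \<boxtimes> B) \<odot> brd D P) \<bullet> (brd (B \<boxtimes> D) M \<odot> idt P)"
    by (simp add: brd_hexagon' tns_cmp del: tns_assoc)
  finally have *: "(brd B M \<odot> idt (P \<boxtimes> D)) \<bullet> (idt B \<odot> brd D (M \<boxtimes> P)) =
     (idt (M \<boxtimes> B) \<odot> brd D P) \<bullet> (brd (B \<boxtimes> D) M \<odot> idt P)" .
  have "(mid A B M P \<odot> idt D \<odot> idt R) \<bullet> mid (A \<boxtimes> B) D (M \<boxtimes> P) R =
     idt A \<odot> ((brd B M \<odot> idt (P \<boxtimes> D)) \<bullet> (idt B \<odot> brd D (M \<boxtimes> P))) \<odot> idt R"
    unfolding mid_def by (simp add: tns_idt whisker)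
  also have "\<dots> = (idt A \<odot> idt M \<odot> mid B D P R) \<bullet> mid A (B \<boxtimes> D) M (P \<boxtimes> R)"
    unfolding mid_def * by (simp add: tns_idt whisker)
  finally show ?thesis .
qed

text \<open>On the left, \<open>B\<close> and \<open>M\<close> cross twice, and symmetry cancels the
  double crossing.\<close>

lemma brd_mid:
  assumes [simp]: "A \<in> Ob C" "B \<in> Ob C" "M \<in> Ob C" "P \<in> Ob C"
  shows "brd (A \<boxtimes> M) (B \<boxtimes> P) \<bullet> mid A B M P = mid B A P M \<bullet> (brd A B \<odot> brd M P)"
proof -
  have "brd (A \<boxtimes> M) (B \<boxtimes> P) \<bullet> mid A B M P =
     (brd A (B \<boxtimes> P) \<odot> idt M) \<bullet> (idt A \<odot> brd M (B \<boxtimes> P)) \<bullet> (idt A \<odot> brd B M \<odot> idt P)"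
    by (simp add: mid_def brd_hexagon'[of A])
  also have "(idt A \<odot> brd M (B \<boxtimes> P)) \<bullet> (idt A \<odot> brd B M \<odot> idt P) =
     idt A \<odot> ((idt B \<odot> brd M P) \<bullet> ((brd M B \<bullet> brd B M) \<odot> idt P))"
    by (simp add: brd_hexagon tns_cmp)
  also have "\<dots> = idt (A \<boxtimes> B) \<odot> brd M P"
    by (simp add: brd_sym tns_cmp tns_idt)
  also have "(brd A (B \<boxtimes> P) \<odot> idt M) \<bullet> \<dots> =
    (idt B \<odot> brd A P \<odot> idt M) \<bullet> (brd A B \<odot> idt (P \<boxtimes> M)) \<bullet> (idt (A \<boxtimes> B) \<odot> brd M P)"
    by (simp add: brd_hexagon tns_idt) (simp add: tns_cmp_cmp flip: tns_assoc)
  also have "\<dots> = mid B A P M \<bullet> (brd A B \<odot> brd M P)"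
    by (simp add: mid_def tns_cmp)
  finally show ?thesis .
qed

text \<open>Here \<open>D\<close> and \<open>E'\<close> are the factors crossing twice on the left;
  symmetry cancels the pair.\<close>

lemma mid_brd:
  assumes [simp]: "D \<in> Ob C" "D' \<in> Ob C" "E \<in> Ob C" "E' \<in> Ob C"
  shows "mid E E' D D' \<bullet> brd (D \<boxtimes> D') (E \<boxtimes> E') = (brd D E \<odot> brd D' E') \<bullet> mid D D' E E'"
proof -
  have "mid E E' D D' \<bullet> brd (D \<boxtimes> D') (E \<boxtimes> E') =
    (idt E \<odot> brd E' D \<odot> idt D') \<bullet> (brd D (E \<boxtimes> E') \<odot> idt D') \<bullet> (idt D \<odot> brd D' (E \<boxtimes> E'))"
    by (simp add: mid_def brd_hexagon'[of D])
  also have "\<dots> = ((idt E \<odot> brd E' D \<odot> idt D') \<bullet> (brd D (E \<boxtimes> E') \<odot> idt D')) \<bullet> (idt D \<odot> brd D' (E \<boxtimes> E'))"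
    by simp
  also have "(idt E \<odot> brd E' D \<odot> idt D') \<bullet> (brd D (E \<boxtimes> E') \<odot> idt D') =
    ((idt E \<odot> (brd E' D \<bullet> brd D E')) \<bullet> (brd D E \<odot> idt E')) \<odot> idt D'"
    by (simp add: brd_hexagon tns_cmp flip: tns_assoc) (simp add: tns_cmp_cmp)
  also have "\<dots> = brd D E \<odot> idt (E' \<boxtimes> D')"
    by (simp add: brd_sym tns_cmp tns_idt)
  also have "\<dots> \<bullet> (idt D \<odot> brd D' (E \<boxtimes> E')) =
    (brd D E \<odot> idt (E' \<boxtimes> D')) \<bullet> (idt (D \<boxtimes> E) \<odot> brd D' E') \<bullet> (idt D \<odot> brd D' E \<odot> idt E')"
    by (simp add: brd_hexagon tns_cmp tns_idt)
  also have "\<dots> = (brd D E \<odot> brd D' E') \<bullet> mid D D' E E'"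
    by (simp add: mid_def tns_cmp_cmp)
  finally show ?thesis .
qed


section \<open>Diagonal products over a comultiplication\<close>

text \<open>Only the comultiplication enters the diagonal product, so no counit or coassociativity is required here.\<close>

definition comult :: "('o, 'm) arrow \<Rightarrow> bool"
  where "comult d \<longleftrightarrow> arr d \<and> cd d = dm d \<boxtimes> dm d"

definition comult_hom :: "('o, 'm) arrow \<Rightarrow> ('o, 'm) arrow \<Rightarrow> ('o, 'm) arrow \<Rightarrow> bool"
  where "comult_hom d e f \<longleftrightarrow>
    comult d \<and> comult e \<and> arr f \<and> dm f = dm d \<and> cd f = dm e \<and> e \<bullet> f = (f \<odot> f) \<bullet> d"

definition tensor_comul :: "('o, 'm) arrow \<Rightarrow> ('o, 'm) arrow \<Rightarrow> ('o, 'm) arrow"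
  where "tensor_comul d e = mid (dm d) (dm d) (dm e) (dm e) \<bullet> (d \<odot> e)"

text \<open>\<open>M\<close> and \<open>P\<close> are arguments because they cannot be recovered
  from the tensor products \<open>dm x\<close> and \<open>dm y\<close>. The targets are
  unrestricted, so composites and pullbacks of actions fit as well.\<close>

definition diag :: "('o, 'm) arrow \<Rightarrow> 'o \<Rightarrow> ('o, 'm) arrow \<Rightarrow> 'o \<Rightarrow> ('o, 'm) arrow \<Rightarrow> ('o, 'm) arrow"
  where "diag d M x P y = (x \<odot> y) \<bullet> mid (dm d) (dm d) M P \<bullet> (d \<odot> idt M \<odot> idt P)"

lemma comultD [simp]: "comult d \<Longrightarrow> arr d" "comult d \<Longrightarrow> cd d = dm d \<boxtimes> dm d"
  by (simp_all add: comult_def)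

lemma comultI: "\<lbrakk>arr d; cd d = dm d \<boxtimes> dm d\<rbrakk> \<Longrightarrow> comult d"
  by (simp only: comult_def)

lemma comult_homD:
  assumes "comult_hom d e f"
  shows "comult d" "comult e" "arr f" "dm f = dm d" "cd f = dm e" "e \<bullet> f = (f \<odot> f) \<bullet> d"
  using assms by (auto simp: comult_hom_def)

lemma tensor_comul_projections [simp]:
  "\<lbrakk>comult d; comult e\<rbrakk> \<Longrightarrow> dm (tensor_comul d e) = dm d \<boxtimes> dm e"
  "\<lbrakk>comult d; comult e\<rbrakk> \<Longrightarrow> comult (tensor_comul d e)"
  by (auto intro!: comultI simp: tensor_comul_def)

lemma diag_projections [simp]:
  "\<lbrakk>comult d; M \<in> Ob C; P \<in> Ob C\<rbrakk> \<Longrightarrow> dm (diag d M x P y) = dm d \<boxtimes> M \<boxtimes> P"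
  "\<lbrakk>comult d; M \<in> Ob C; P \<in> Ob C\<rbrakk> \<Longrightarrow> cd (diag d M x P y) = cd x \<boxtimes> cd y"
  "\<lbrakk>comult d; M \<in> Ob C; P \<in> Ob C; arr x; arr y; dm x = dm d \<boxtimes> M; dm y = dm d \<boxtimes> P\<rbrakk>
    \<Longrightarrow> arr (diag d M x P y)"
  by (simp_all add: diag_def)

text \<open>Since \<open>f\<close> is comultiplicative, it splits into \<open>f \<odot> f\<close>
  before the interchange, and naturality of \<open>mid\<close> hands one copy of \<open>f\<close> to
  each factor. With \<open>f\<close> an identity this serves module morphisms, with \<open>r\<close>
  and \<open>s\<close> identities it is pullback.\<close>

lemma diag_natural:
  assumes "comult_hom d e f" and [simp]: "arr r" "arr s" "arr x" "arr y"
    "dm x = dm e \<boxtimes> cd r" "dm y = dm e \<boxtimes> cd s"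
  shows "diag e (cd r) x (cd s) y \<bullet> (f \<odot> r \<odot> s) =
    diag d (dm r) (x \<bullet> (f \<odot> r)) (dm s) (y \<bullet> (f \<odot> s))"
proof -
  note [simp] = comult_homD(1-5)[OF assms(1)]
  have "diag e (cd r) x (cd s) y \<bullet> (f \<odot> r \<odot> s) =
      (x \<odot> y) \<bullet> mid (dm e) (dm e) (cd r) (cd s) \<bullet> ((e \<bullet> f) \<odot> r \<odot> s)"
    by (simp add: diag_def tns_cmp)
  also have "\<dots> = (x \<odot> y) \<bullet> (mid (dm e) (dm e) (cd r) (cd s) \<bullet> (f \<odot> f \<odot> r \<odot> s)) \<bullet> (d \<odot> idt (dm r) \<odot> idt (dm s))"
    by (simp add: comult_homD(6)[OF assms(1)] tns_cmp flip: tns_assoc)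
  also have "mid (dm e) (dm e) (cd r) (cd s) \<bullet> (f \<odot> f \<odot> r \<odot> s) =
      ((f \<odot> r) \<odot> (f \<odot> s)) \<bullet> mid (dm d) (dm d) (dm r) (dm s)"
    using mid_natural[of f f r s] by simp
  also have "(x \<odot> y) \<bullet> \<dots> \<bullet> (d \<odot> idt (dm r) \<odot> idt (dm s)) =
      diag d (dm r) (x \<bullet> (f \<odot> r)) (dm s) (y \<bullet> (f \<odot> s))"
    by (simp add: diag_def tns_cmp_cmp del: tns_assoc)
  finally show ?thesis .
qed

lemma diag_pullback:
  assumes "comult_hom d e f" and [simp]: "M \<in> Ob C" "P \<in> Ob C" "arr x" "arr y"
    "dm x = dm e \<boxtimes> M" "dm y = dm e \<boxtimes> P"
  shows "diag e M x P y \<bullet> (f \<odot> idt M \<odot> idt P) =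
    diag d M (x \<bullet> (f \<odot> idt M)) P (y \<bullet> (f \<odot> idt P))"
  using diag_natural[OF assms(1), of "idt M" "idt P" x y] by simp

lemma diag_post:
  assumes [simp]: "comult d" "arr x" "arr y" "M \<in> Ob C" "P \<in> Ob C" "dm x = dm d \<boxtimes> M" "dm y = dm d \<boxtimes> P"
    "arr r" "arr s" "dm r = cd x" "dm s = cd y"
  shows "(r \<odot> s) \<bullet> diag d M x P y = diag d M (r \<bullet> x) P (s \<bullet> y)"
  by (simp add: diag_def tns_cmp_cmp)

text \<open>Expanding both sides leaves two nested interchanges, which \<open>mid_assoc\<close>
  identifies; the rest is naturality.\<close>

lemma diag_comp:
  assumes [simp]: "comult e" "comult d" "M \<in> Ob C" "P \<in> Ob C"
    "arr x" "dm x = dm d \<boxtimes> M" "arr y" "dm y = dm d \<boxtimes> P"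
    "arr x'" "dm x' = dm e \<boxtimes> cd x" "arr y'" "dm y' = dm e \<boxtimes> cd y"
  shows "diag (tensor_comul e d) M (x' \<bullet> (idt (dm e) \<odot> x)) P (y' \<bullet> (idt (dm e) \<odot> y)) =
    diag e (cd x) x' (cd y) y' \<bullet> (idt (dm e) \<odot> diag d M x P y)"
proof -
  let ?E = "dm e" let ?D = "dm d"
  \<comment> \<open>The interchange hidden in \<open>tensor_comul e d\<close> is brought next to
    that of the outer \<open>diag\<close>, where \<open>mid_assoc\<close> applies.\<close>
  have "diag (tensor_comul e d) M (x' \<bullet> (idt ?E \<odot> x)) P (y' \<bullet> (idt ?E \<odot> y)) =
      (x' \<odot> y') \<bullet> ((idt ?E \<odot> x) \<odot> (idt ?E \<odot> y)) \<bullet>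
      (mid (?E \<boxtimes> ?D) (?E \<boxtimes> ?D) M P \<bullet> (mid ?E ?E ?D ?D \<odot> idt M \<odot> idt P)) \<bullet> (e \<odot> d \<odot> idt M \<odot> idt P)"
  proof -
    have "tensor_comul e d \<odot> idt M \<odot> idt P =
        (mid ?E ?E ?D ?D \<odot> idt M \<odot> idt P) \<bullet> (e \<odot> d \<odot> idt M \<odot> idt P)"
      by (simp add: tensor_comul_def tns_cmp flip: tns_assoc)
    then show ?thesis
      by (simp add: diag_def tns_cmp_cmp del: tns_assoc)
  qed
  also have "mid (?E \<boxtimes> ?D) (?E \<boxtimes> ?D) M P \<bullet> (mid ?E ?E ?D ?D \<odot> idt M \<odot> idt P) =
      mid ?E ?E (?D \<boxtimes> M) (?D \<boxtimes> P) \<bullet> (idt ?E \<odot> idt ?E \<odot> mid ?D ?D M P)"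
    by (simp add: mid_assoc)
  also have "(x' \<odot> y') \<bullet> ((idt ?E \<odot> x) \<odot> (idt ?E \<odot> y)) \<bullet> \<dots> \<bullet> (e \<odot> d \<odot> idt M \<odot> idt P) =
      (x' \<odot> y') \<bullet> (((idt ?E \<odot> x) \<odot> (idt ?E \<odot> y)) \<bullet> mid ?E ?E (?D \<boxtimes> M) (?D \<boxtimes> P)) \<bullet>
        ((idt ?E \<odot> idt ?E \<odot> mid ?D ?D M P) \<bullet> (e \<odot> d \<odot> idt M \<odot> idt P))"
    by simp
  \<comment> \<open>Naturality lets \<open>x\<close> and \<open>y\<close> act before the outer
    interchange, where they complete the inner \<open>diag d\<close>.\<close>
  also have "((idt ?E \<odot> x) \<odot> (idt ?E \<odot> y)) \<bullet> mid ?E ?E (?D \<boxtimes> M) (?D \<boxtimes> P) =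
      mid ?E ?E (cd x) (cd y) \<bullet> (idt ?E \<odot> idt ?E \<odot> x \<odot> y)"
    using mid_natural[of "idt ?E" "idt ?E" x y] by simp
  also have "(x' \<odot> y') \<bullet> \<dots> \<bullet> (idt ?E \<odot> idt ?E \<odot> mid ?D ?D M P) \<bullet> (e \<odot> d \<odot> idt M \<odot> idt P) =
      (x' \<odot> y') \<bullet> mid ?E ?E (cd x) (cd y) \<bullet> (e \<odot> diag d M x P y)"
    using tns_cmp[of "idt ?E \<odot> idt ?E" e "(x \<odot> y) \<bullet> mid ?D ?D M P" "d \<odot> idt M \<odot> idt P"]
    by (simp add: diag_def whisker)
  also have "\<dots> = diag e (cd x) x' (cd y) y' \<bullet> (idt (dm e) \<odot> diag d M x P y)"
    using tns_cmp[of e "idt ?E" "idt (cd x \<boxtimes> cd y)" "diag d M x P y"]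
    by (simp add: diag_def[of e] tns_idt)
  finally show ?thesis .
qed

section \<open>Comultiplicative maps and tensor products of comultiplications\<close>

lemma comult_hom_idt: "comult d \<Longrightarrow> comult_hom d d (idt (dm d))"
  by (simp add: comult_hom_def)

lemma comult_hom_cmp:
  assumes "comult_hom d e f" "comult_hom e k g"
  shows "comult_hom d k (g \<bullet> f)"
proof -
  note [simp] = comult_homD(1-5)[OF assms(1)] comult_homD(1-5)[OF assms(2)]
  have "k \<bullet> g \<bullet> f = (k \<bullet> g) \<bullet> f" by simp
  also have "\<dots> = (g \<odot> g) \<bullet> (e \<bullet> f)" unfolding comult_homD(6)[OF assms(2)] by simp
  also have "\<dots> = ((g \<bullet> f) \<odot> (g \<bullet> f)) \<bullet> d"
    unfolding comult_homD(6)[OF assms(1)] by (simp add: tns_cmp_cmp)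
  finally show ?thesis by (simp add: comult_hom_def)
qed

lemma comult_hom_tns:
  assumes "comult_hom d d' f" "comult_hom e e' g"
  shows "comult_hom (tensor_comul d e) (tensor_comul d' e') (f \<odot> g)"
proof -
  note [simp] = comult_homD(1-5)[OF assms(1)] comult_homD(1-5)[OF assms(2)]
  have "tensor_comul d' e' \<bullet> (f \<odot> g) = mid (dm d') (dm d') (dm e') (dm e') \<bullet> ((d' \<bullet> f) \<odot> (e' \<bullet> g))"
    by (simp add: tensor_comul_def tns_cmp)
  also have "\<dots> = (mid (dm d') (dm d') (dm e') (dm e') \<bullet> (f \<odot> f \<odot> g \<odot> g)) \<bullet> (d \<odot> e)"
    unfolding comult_homD(6)[OF assms(1)] comult_homD(6)[OF assms(2)]
    using tns_cmp[of "f \<odot> f" d "g \<odot> g" e] by simp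
  also have "mid (dm d') (dm d') (dm e') (dm e') \<bullet> (f \<odot> f \<odot> g \<odot> g) =
      ((f \<odot> g) \<odot> (f \<odot> g)) \<bullet> mid (dm d) (dm d) (dm e) (dm e)"
    using mid_natural[of f f g g] by simp
  also have "\<dots> \<bullet> (d \<odot> e) = ((f \<odot> g) \<odot> (f \<odot> g)) \<bullet> tensor_comul d e"
    by (simp add: tensor_comul_def)
  finally show ?thesis by (simp add: comult_hom_def)
qed

text \<open>Naturality moves the braiding past \<open>d \<odot> e\<close>, and
  \<open>mid_brd\<close> past the interchange.\<close>

lemma comult_hom_brd:
  assumes [simp]: "comult d" "comult e"
  shows "comult_hom (tensor_comul d e) (tensor_comul e d) (brd (dm d) (dm e))"
proof -
  have "tensor_comul e d \<bullet> brd (dm d) (dm e) =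
      mid (dm e) (dm e) (dm d) (dm d) \<bullet> (brd (cd d) (cd e) \<bullet> (d \<odot> e))"
    unfolding tensor_comul_def by (subst brd_natural) simp_all
  also have "\<dots> = (mid (dm e) (dm e) (dm d) (dm d) \<bullet> brd (dm d \<boxtimes> dm d) (dm e \<boxtimes> dm e)) \<bullet> (d \<odot> e)"
    by simp
  also have "\<dots> = (brd (dm d) (dm e) \<odot> brd (dm d) (dm e)) \<bullet> tensor_comul d e"
    unfolding tensor_comul_def by (subst mid_brd) simp_all
  finally show ?thesis by (simp add: comult_hom_def)
qed

text \<open>An instance of \<open>mid_assoc\<close>; it lets comultiplicative maps on threefold
  products compose without rebracketing.\<close>

lemma tensor_comul_assoc:
  assumes [simp]: "comult d" "comult e" "comult k"
  shows "tensor_comul (tensor_comul d e) k = tensor_comul d (tensor_comul e k)"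
proof -
  let ?D = "dm d" let ?E = "dm e" let ?K = "dm k"
  have "tensor_comul (tensor_comul d e) k =
      (mid (?D \<boxtimes> ?E) (?D \<boxtimes> ?E) ?K ?K \<bullet> (mid ?D ?D ?E ?E \<odot> idt ?K \<odot> idt ?K)) \<bullet> ((d \<odot> e) \<odot> k)"
    using tns_cmp[of "mid ?D ?D ?E ?E" "d \<odot> e" "idt ?K \<odot> idt ?K" k]
    by (simp add: tensor_comul_def)
  also have "\<dots> = mid ?D ?D (?E \<boxtimes> ?K) (?E \<boxtimes> ?K) \<bullet> ((idt ?D \<odot> idt ?D) \<odot> mid ?E ?E ?K ?K) \<bullet> (d \<odot> e \<odot> k)"
    by (simp add: mid_assoc)
  also have "\<dots> = tensor_comul d (tensor_comul e k)"
    by (simp add: tensor_comul_def tns_cmp del: tns_assoc)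
  finally show ?thesis .
qed

text \<open>Coassociativity rewrites \<open>(d \<odot> d) \<bullet> d\<close> so that the two middle
  outputs come from a single \<open>d\<close>. The interchange swaps exactly these, and
  cocommutativity absorbs the swap.\<close>

lemma comult_hom_comult:
  assumes [simp]: "comult d" and coassoc: "(d \<odot> idt (dm d)) \<bullet> d = (idt (dm d) \<odot> d) \<bullet> d"
    and cocomm: "brd (dm d) (dm d) \<bullet> d = d"
  shows "comult_hom d (tensor_comul d d) d"
proof -
  let ?D = "dm d"
  have "(d \<odot> d) \<bullet> d = (d \<odot> idt (?D \<boxtimes> ?D)) \<bullet> ((idt ?D \<odot> d) \<bullet> d)"
    by (simp add: tns_cmp_cmp)
  also have "\<dots> = (((d \<odot> idt ?D) \<bullet> d) \<odot> idt ?D) \<bullet> d"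
    by (simp add: tns_idt tns_cmp_cmp flip: coassoc tns_assoc)
  also have "\<dots> = (idt ?D \<odot> d \<odot> idt ?D) \<bullet> (d \<odot> idt ?D) \<bullet> d"
    by (simp add: coassoc whisker)
  finally have *: "(d \<odot> d) \<bullet> d = (idt ?D \<odot> d \<odot> idt ?D) \<bullet> (d \<odot> idt ?D) \<bullet> d" .
  have "mid ?D ?D ?D ?D \<bullet> (d \<odot> d) \<bullet> d = (idt ?D \<odot> (brd ?D ?D \<bullet> d) \<odot> idt ?D) \<bullet> (d \<odot> idt ?D) \<bullet> d"
    unfolding * mid_def by (simp add: whisker)
  also have "\<dots> = (d \<odot> d) \<bullet> d" by (simp add: cocomm *)
  finally have "tensor_comul d d \<bullet> d = (d \<odot> d) \<bullet> d" by (simp add: tensor_comul_def)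
  then show ?thesis by (simp add: comult_hom_def)
qed

section \<open>Associativity, symmetry and unit laws of the diagonal product\<close>

text \<open>Both sides distribute three copies of \<open>dm d\<close> over \<open>x\<close>,
  \<open>y\<close>, \<open>z\<close>. They differ in the order of comultiplying and of
  interchanging, settled by \<open>coassoc\<close> and \<open>mid_assoc'\<close>.\<close>

lemma diag_assoc:
  assumes [simp]: "comult d" "M \<in> Ob C" "P \<in> Ob C" "R \<in> Ob C"
    "arr x" "dm x = dm d \<boxtimes> M" "arr y" "dm y = dm d \<boxtimes> P" "arr z" "dm z = dm d \<boxtimes> R"
    and coassoc: "(d \<odot> idt (dm d)) \<bullet> d = (idt (dm d) \<odot> d) \<bullet> d"
  shows "diag d (M \<boxtimes> P) (diag d M x P y) R z = diag d M x (P \<boxtimes> R) (diag d P y R z)"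
proof -
  let ?D = "dm d"
  have "diag d (M \<boxtimes> P) (diag d M x P y) R z =
     (x \<odot> y \<odot> z) \<bullet> (mid ?D ?D M P \<odot> idt ?D \<odot> idt R) \<bullet>
      ((d \<odot> idt (M \<boxtimes> P) \<odot> idt ?D \<odot> idt R) \<bullet> mid ?D ?D (M \<boxtimes> P) R) \<bullet> (d \<odot> idt (M \<boxtimes> P) \<odot> idt R)"
  proof -
    have "diag d M x P y \<odot> z = (x \<odot> y \<odot> z) \<bullet> (mid ?D ?D M P \<odot> idt ?D \<odot> idt R) \<bullet> (d \<odot> idt (M \<boxtimes> P) \<odot> idt ?D \<odot> idt R)"
      using tns_cmp[of "x \<odot> y" "mid ?D ?D M P \<bullet> (d \<odot> idt M \<odot> idt P)" z "idt ?D \<odot> idt R"]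
        tns_cmp[of "mid ?D ?D M P" "d \<odot> idt M \<odot> idt P" "idt ?D \<odot> idt R" "idt ?D \<odot> idt R"]
      by (simp add: diag_def tns_idt)
    then show ?thesis by (simp add: diag_def[of d "M \<boxtimes> P"])
  qed
  \<comment> \<open>Moving the inner \<open>d\<close> before the outer interchange makes the two
    comultiplications adjacent.\<close>
  also have "(d \<odot> idt (M \<boxtimes> P) \<odot> idt ?D \<odot> idt R) \<bullet> mid ?D ?D (M \<boxtimes> P) R =
     mid (?D \<boxtimes> ?D) ?D (M \<boxtimes> P) R \<bullet> (d \<odot> idt ?D \<odot> idt (M \<boxtimes> P) \<odot> idt R)"
    using mid_natural[of d "idt ?D" "idt (M \<boxtimes> P)" "idt R"] by simp
  also have "(x \<odot> y \<odot> z) \<bullet> (mid ?D ?D M P \<odot> idt ?D \<odot> idt R) \<bullet> \<dots> \<bullet> (d \<odot> idt (M \<boxtimes> P) \<odot> idt R) =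
    (x \<odot> y \<odot> z) \<bullet> ((mid ?D ?D M P \<odot> idt ?D \<odot> idt R) \<bullet> mid (?D \<boxtimes> ?D) ?D (M \<boxtimes> P) R) \<bullet>
      (((d \<odot> idt ?D) \<bullet> d) \<odot> (idt (M \<boxtimes> P) \<odot> idt R))"
    using tns_cmp[of "d \<odot> idt ?D" d "idt (M \<boxtimes> P) \<odot> idt R" "idt (M \<boxtimes> P) \<odot> idt R"] by simp
  \<comment> \<open>The bracketing changes here; the remaining steps undo the expansion on the other
    side.\<close>
  also have "\<dots> = (x \<odot> y \<odot> z) \<bullet> ((idt ?D \<odot> idt M \<odot> mid ?D ?D P R) \<bullet> mid ?D (?D \<boxtimes> ?D) M (P \<boxtimes> R)) \<bullet>
      (((idt ?D \<odot> d) \<bullet> d) \<odot> (idt (M \<boxtimes> P) \<odot> idt R))"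
    by (simp add: mid_assoc' coassoc)
  also have "\<dots> = (x \<odot> y \<odot> z) \<bullet> (idt ?D \<odot> idt M \<odot> mid ?D ?D P R) \<bullet> (mid ?D (?D \<boxtimes> ?D) M (P \<boxtimes> R) \<bullet>
      (idt ?D \<odot> d \<odot> idt M \<odot> idt (P \<boxtimes> R))) \<bullet> (d \<odot> idt M \<odot> idt (P \<boxtimes> R))"
    using tns_cmp[of "idt ?D \<odot> d" d "idt M \<odot> idt (P \<boxtimes> R)" "idt M \<odot> idt (P \<boxtimes> R)"]
    by (simp add: tns_idt)
  also have "mid ?D (?D \<boxtimes> ?D) M (P \<boxtimes> R) \<bullet> (idt ?D \<odot> d \<odot> idt M \<odot> idt (P \<boxtimes> R)) =
    (idt ?D \<odot> idt M \<odot> d \<odot> idt (P \<boxtimes> R)) \<bullet> mid ?D ?D M (P \<boxtimes> R)"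
    using mid_natural[of "idt ?D" d "idt M" "idt (P \<boxtimes> R)"] by simp
  also have "(x \<odot> y \<odot> z) \<bullet> (idt ?D \<odot> idt M \<odot> mid ?D ?D P R) \<bullet> \<dots> \<bullet> (d \<odot> idt M \<odot> idt (P \<boxtimes> R)) =
    diag d M x (P \<boxtimes> R) (diag d P y R z)"
  proof -
    have "x \<odot> diag d P y R z = (x \<odot> (y \<odot> z)) \<bullet> ((idt ?D \<odot> idt M) \<odot> mid ?D ?D P R) \<bullet> ((idt ?D \<odot> idt M) \<odot> (d \<odot> idt (P \<boxtimes> R)))"
      by (simp add: diag_def tns_idt tns_cmp del: tns_assoc)
    then show ?thesis by (simp add: diag_def[of d M])
  qed
  finally show ?thesis .
qed

text \<open>By naturality and \<open>brd_mid\<close> the braiding passes to the inputs as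
  \<open>brd (dm d) (dm d)\<close> and \<open>brd M P\<close>; cocommutativity absorbs the
  former.\<close>

lemma brd_diag:
  assumes [simp]: "comult d" "M \<in> Ob C" "P \<in> Ob C"
    "arr x" "dm x = dm d \<boxtimes> M" "arr y" "dm y = dm d \<boxtimes> P"
    and cocomm: "brd (dm d) (dm d) \<bullet> d = d"
  shows "brd (cd x) (cd y) \<bullet> diag d M x P y = diag d P y M x \<bullet> (idt (dm d) \<odot> brd M P)"
proof -
  let ?D = "dm d"
  have "brd (cd x) (cd y) \<bullet> diag d M x P y =
     (brd (cd x) (cd y) \<bullet> (x \<odot> y)) \<bullet> mid ?D ?D M P \<bullet> (d \<odot> idt M \<odot> idt P)"
    by (simp add: diag_def)
  also have "\<dots> = (y \<odot> x) \<bullet> (brd (?D \<boxtimes> M) (?D \<boxtimes> P) \<bullet> mid ?D ?D M P) \<bullet> (d \<odot> idt M \<odot> idt P)"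
    by (simp add: brd_natural)
  also have "\<dots> = (y \<odot> x) \<bullet> mid ?D ?D P M \<bullet> ((brd ?D ?D \<bullet> d) \<odot> brd M P)"
    by (simp add: brd_mid tns_cmp)
  also have "\<dots> = diag d P y M x \<bullet> (idt (dm d) \<odot> brd M P)"
    by (simp add: cocomm diag_def tns_cmp)
  finally show ?thesis .
qed

text \<open>A trivial action on one factor deletes one output of \<open>d\<close>, and the counit
  law removes the other trace of \<open>d\<close>.\<close>

lemma diag_counit:
  assumes [simp]: "comult d" "M \<in> Ob C" "arr x" "dm x = dm d \<boxtimes> M" "arr e" "dm e = dm d" "cd e = \<K>"
  shows "(e \<odot> idt (dm d)) \<bullet> d = idt (dm d) \<Longrightarrow> diag d \<K> e M x = x"
    and "(idt (dm d) \<odot> e) \<bullet> d = idt (dm d) \<Longrightarrow> diag d M x \<K> e = x"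
proof -
  let ?D = "dm d"
  have *: "e \<odot> x = x \<bullet> (e \<odot> idt (?D \<boxtimes> M))" "(x \<odot> e) = x \<bullet> (idt (?D \<boxtimes> M) \<odot> e)"
    using tns_cmp[of "idt \<K>" e x "idt (?D \<boxtimes> M)"] tns_cmp[of x "idt (?D \<boxtimes> M)" "idt \<K>" e] by simp_all
  have brd: "brd \<K> Y = idt Y" if "Y \<in> Ob C" for Y
    using brd_sym[of Y \<K>] that by simp
  show "diag d \<K> e M x = x" if "(e \<odot> idt ?D) \<bullet> d = idt ?D"
  proof -
    have "diag d \<K> e M x = x \<bullet> (((e \<odot> idt ?D) \<bullet> d) \<odot> idt M)"
      by (simp add: diag_def mid_def * tns_idt whisker)
    with that show ?thesis by simp
  qed
  show "diag d M x \<K> e = x" if "(idt ?D \<odot> e) \<bullet> d = idt ?D"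
  proof -
    \<comment> \<open>The output of \<open>d\<close> to be deleted first crosses \<open>M\<close>;
      by naturality it may be deleted before crossing.\<close>
    have "(idt M \<odot> e) \<bullet> brd ?D M = e \<odot> idt M"
      using brd_natural[of e "idt M"] by (simp add: brd)
    then have "x \<bullet> (idt ?D \<odot> ((idt M \<odot> e) \<bullet> brd ?D M)) \<bullet> (d \<odot> idt M) =
        x \<bullet> (((idt ?D \<odot> e) \<bullet> d) \<odot> idt M)"
      by (simp add: whisker)
    with that show ?thesis by (simp add: diag_def mid_def * tns_idt whisker)
  qed
qed


section \<open>Module conditions for diagonal products\<close>

definition left_mod :: "('o, 'm) arrow \<Rightarrow> ('o, 'm) arrow \<Rightarrow> 'o \<Rightarrow> ('o, 'm) arrow \<Rightarrow> bool"
  where "left_mod u m M x \<longleftrightarrow> M \<in> Ob C \<and> arr x \<and> dm x = cd u \<boxtimes> M \<and> cd x = M \<and>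
    x \<bullet> (u \<odot> idt M) = idt M \<and> x \<bullet> (idt (cd u) \<odot> x) = x \<bullet> (m \<odot> idt M)"

lemma left_modD:
  assumes "left_mod u m M x"
  shows "M \<in> Ob C" "arr x" "dm x = cd u \<boxtimes> M" "cd x = M" "x \<bullet> (u \<odot> idt M) = idt M"
    "x \<bullet> (idt (cd u) \<odot> x) = x \<bullet> (m \<odot> idt M)"
  using assms by (auto simp: left_mod_def)

text \<open>Each module law equates a composite with a pullback, along \<open>u\<close> or
  \<open>m\<close>. Both maps are comultiplicative, so \<open>diag_pullback\<close> and
  \<open>diag_comp\<close> carry the laws over.\<close>

lemma left_mod_diag:
  assumes u: "comult_hom (idt \<K>) d u" and m: "comult_hom (tensor_comul d d) d m"
    and x: "left_mod u m M x" and y: "left_mod u m P y"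
  shows "left_mod u m (M \<boxtimes> P) (diag d M x P y)"
proof -
  note [simp] = comult_homD(1-5)[OF u] comult_homD(1-5)[OF m] left_modD(1-4)[OF x] left_modD(1-4)[OF y]
  have "diag d M x P y \<bullet> (u \<odot> idt M \<odot> idt P) = diag (idt \<K>) M (idt M) P (idt P)"
    by (subst diag_pullback[OF u]) (simp_all add: left_modD(5)[OF x] left_modD(5)[OF y])
  also have "\<dots> = idt M \<odot> idt P"
    using brd_sym[of M \<K>] by (simp add: diag_def mid_def)
  finally have 1: "diag d M x P y \<bullet> (u \<odot> idt M \<odot> idt P) = idt M \<odot> idt P" .
  have "diag d M x P y \<bullet> (idt (dm d) \<odot> diag d M x P y) =
      diag (tensor_comul d d) M (x \<bullet> (idt (dm d) \<odot> x)) P (y \<bullet> (idt (dm d) \<odot> y))"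
    using diag_comp[of d d M P x y x y] by simp
  also have "\<dots> = diag (tensor_comul d d) M (x \<bullet> (m \<odot> idt M)) P (y \<bullet> (m \<odot> idt P))"
    using left_modD(6)[OF x] left_modD(6)[OF y] by simp
  also have "\<dots> = diag d M x P y \<bullet> (m \<odot> idt M \<odot> idt P)"
    by (subst diag_pullback[OF m]) simp_all
  finally show ?thesis
    using 1 by (simp add: left_mod_def tns_idt)
qed

text \<open>The map is a composite of three comultiplicative ones: a copy of \<open>b\<close>, a
  braiding and a copy of \<open>a\<close>; \<open>tensor_comul_assoc\<close> matches the
  comultiplications in between.\<close>

lemma twist_comult_hom:
  assumes [simp]: "comult b" "comult h" and b: "comult_hom b (tensor_comul b b) b"
    and a: "comult_hom (tensor_comul b h) h a"
  shows "comult_hom (tensor_comul b h) (tensor_comul h b)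
    ((a \<odot> idt (dm b)) \<bullet> (idt (dm b) \<odot> brd (dm b) (dm h)) \<bullet> (b \<odot> idt (dm h)))"
proof -
  have 1: "comult_hom (tensor_comul b h) (tensor_comul b (tensor_comul b h)) (b \<odot> idt (dm h))"
    using comult_hom_tns[OF b comult_hom_idt[of h]] by (simp add: tensor_comul_assoc)
  have 2: "comult_hom (tensor_comul b (tensor_comul b h)) (tensor_comul b (tensor_comul h b))
      (idt (dm b) \<odot> brd (dm b) (dm h))"
    using comult_hom_tns[OF comult_hom_idt[of b] comult_hom_brd[of b h]] by simp
  have 3: "comult_hom (tensor_comul b (tensor_comul h b)) (tensor_comul h b) (a \<odot> idt (dm b))"
    using comult_hom_tns[OF a comult_hom_idt[of b]] by (simp add: tensor_comul_assoc)
  show ?thesis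
    using comult_hom_cmp[OF comult_hom_cmp[OF 1 2] 3] by simp
qed

text \<open>Read as a pullback along \<open>k\<close>, the compatibility of each factor passes
  through \<open>diag\<close>; \<open>diag_comp\<close> is used once in each direction.\<close>

lemma diag_compatible:
  assumes [simp]: "comult b" "comult h" and b: "comult_hom b (tensor_comul b b) b"
    and a: "comult_hom (tensor_comul b h) h a"
    and [simp]: "M \<in> Ob C" "arr x" "dm x = dm b \<boxtimes> M" "cd x = M" "arr z" "dm z = dm h \<boxtimes> M" "cd z = M"
    and [simp]: "P \<in> Ob C" "arr y" "dm y = dm b \<boxtimes> P" "cd y = P" "arr w" "dm w = dm h \<boxtimes> P" "cd w = P"
    and xz: "x \<bullet> (idt (dm b) \<odot> z) =
      z \<bullet> (a \<odot> x) \<bullet> (idt (dm b) \<odot> brd (dm b) (dm h) \<odot> idt M) \<bullet> (b \<odot> idt (dm h) \<odot> idt M)"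
    and yw: "y \<bullet> (idt (dm b) \<odot> w) =
      w \<bullet> (a \<odot> y) \<bullet> (idt (dm b) \<odot> brd (dm b) (dm h) \<odot> idt P) \<bullet> (b \<odot> idt (dm h) \<odot> idt P)"
  shows "diag b M x P y \<bullet> (idt (dm b) \<odot> diag h M z P w) =
    diag h M z P w \<bullet> (a \<odot> diag b M x P y) \<bullet> (idt (dm b) \<odot> brd (dm b) (dm h) \<odot> idt (M \<boxtimes> P)) \<bullet>
      (b \<odot> idt (dm h) \<odot> idt (M \<boxtimes> P))"
proof -
  let ?B = "dm b" let ?H = "dm h"
  note [simp] = comult_homD(3)[OF a] comult_homD(4,5)[OF a, simplified]
  \<comment> \<open>In Sweedler notation, \<open>k\<close> sends a pair (b, h) to (b_1 . h,
    b_2).\<close>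
  define k where "k = (a \<odot> idt ?B) \<bullet> (idt ?B \<odot> brd ?B ?H) \<bullet> (b \<odot> idt ?H)"
  have k: "comult_hom (tensor_comul b h) (tensor_comul h b) k"
    unfolding k_def using b a by (simp add: twist_comult_hom)
  have [simp]: "arr k" "dm k = ?B \<boxtimes> ?H" "cd k = ?H \<boxtimes> ?B" by (simp_all add: k_def)
  \<comment> \<open>Stated for arbitrary \<open>s\<close> and \<open>t\<close> because it is applied
    to the given actions and, reversed, to the diagonal ones.\<close>
  have twist: "t \<bullet> (a \<odot> s) \<bullet> (idt ?B \<odot> brd ?B ?H \<odot> idt N) \<bullet> (b \<odot> idt ?H \<odot> idt N) =
      (t \<bullet> (idt ?H \<odot> s)) \<bullet> (k \<odot> idt N)"
    if "N \<in> Ob C" "arr s" "dm s = ?B \<boxtimes> N" "cd s = N" "arr t" "dm t = ?H \<boxtimes> N" for N s t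
  proof -
    have "a \<odot> s = (idt ?H \<odot> s) \<bullet> (a \<odot> idt ?B \<odot> idt N)"
      using that tns_cmp[of "idt ?H" a s "idt (?B \<boxtimes> N)"] by (simp add: tns_idt)
    with that show ?thesis by (simp add: k_def whisker)
  qed
  have "diag b M x P y \<bullet> (idt ?B \<odot> diag h M z P w) =
      diag (tensor_comul b h) M (x \<bullet> (idt ?B \<odot> z)) P (y \<bullet> (idt ?B \<odot> w))"
    using diag_comp[of b h M P z w x y] by simp
  also have "\<dots> = diag (tensor_comul b h) M ((z \<bullet> (idt ?H \<odot> x)) \<bullet> (k \<odot> idt M)) P
      ((w \<bullet> (idt ?H \<odot> y)) \<bullet> (k \<odot> idt P))"
    unfolding xz yw by (simp only: twist assms)
  also have "\<dots> = diag (tensor_comul h b) M (z \<bullet> (idt ?H \<odot> x)) P (w \<bullet> (idt ?H \<odot> y)) \<bullet>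
      (k \<odot> idt M \<odot> idt P)"
    by (subst diag_pullback[OF k]) simp_all
  also have "\<dots> = (diag h M z P w \<bullet> (idt ?H \<odot> diag b M x P y)) \<bullet> (k \<odot> idt (M \<boxtimes> P))"
    using diag_comp[of h b M P x y z w] by (simp add: tns_idt)
  also have "\<dots> = diag h M z P w \<bullet> (a \<odot> diag b M x P y) \<bullet> (idt ?B \<odot> brd ?B ?H \<odot> idt (M \<boxtimes> P)) \<bullet>
      (b \<odot> idt ?H \<odot> idt (M \<boxtimes> P))"
    by (rule twist[symmetric]) simp_all
  finally show ?thesis .
qed

text \<open>The hypotheses present the pullback along \<open>t \<odot> g\<close> as \<open>g\<close>
  after a pullback along \<open>h\<close> of a composite. \<open>diag\<close> respects each
  ingredient, so the operations are peeled off one by one.\<close>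

lemma diag_rota_baxter:
  assumes h: "comult_hom h (tensor_comul h h) h" and t: "comult_hom h b t"
    and [simp]: "M \<in> Ob C" "arr x" "dm x = dm b \<boxtimes> M" "cd x = M" "arr z" "dm z = dm h \<boxtimes> M" "cd z = M"
    and [simp]: "P \<in> Ob C" "arr y" "dm y = dm b \<boxtimes> P" "cd y = P" "arr w" "dm w = dm h \<boxtimes> P" "cd w = P"
    and [simp]: "arr n" "dm n = dm b \<boxtimes> cd g" "arr g" "dm g = M" "cd n = cd g"
    and [simp]: "arr q" "dm q = dm b \<boxtimes> cd f" "arr f" "dm f = P" "cd q = cd f"
    and n: "n \<bullet> (t \<odot> g) = g \<bullet> z \<bullet> (idt (dm h) \<odot> (x \<bullet> (t \<odot> idt M))) \<bullet> (h \<odot> idt M)"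
    and q: "q \<bullet> (t \<odot> f) = f \<bullet> w \<bullet> (idt (dm h) \<odot> (y \<bullet> (t \<odot> idt P))) \<bullet> (h \<odot> idt P)"
  shows "diag b (cd g) n (cd f) q \<bullet> (t \<odot> g \<odot> f) =
    (g \<odot> f) \<bullet> diag h M z P w \<bullet> (idt (dm h) \<odot> (diag b M x P y \<bullet> (t \<odot> idt (M \<boxtimes> P)))) \<bullet>
      (h \<odot> idt (M \<boxtimes> P))"
proof -
  let ?H = "dm h"
  note [simp] = comult_homD(1,2)[OF h] comult_homD(1-5)[OF t]
  let ?x = "x \<bullet> (t \<odot> idt M)" and ?y = "y \<bullet> (t \<odot> idt P)"
  have "diag b (cd g) n (cd f) q \<bullet> (t \<odot> g \<odot> f) = diag h M (n \<bullet> (t \<odot> g)) P (q \<bullet> (t \<odot> f))"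
    using diag_natural[OF t, of g f n q] by simp
  also have "\<dots> = (g \<odot> f) \<bullet> diag h M ((z \<bullet> (idt ?H \<odot> ?x)) \<bullet> (h \<odot> idt M)) P
      ((w \<bullet> (idt ?H \<odot> ?y)) \<bullet> (h \<odot> idt P))"
    unfolding n q by (subst diag_post) simp_all
  also have "\<dots> = (g \<odot> f) \<bullet> diag (tensor_comul h h) M (z \<bullet> (idt ?H \<odot> ?x)) P (w \<bullet> (idt ?H \<odot> ?y)) \<bullet>
      (h \<odot> idt M \<odot> idt P)"
    by (subst diag_pullback[OF h]) simp_all
  also have "diag (tensor_comul h h) M (z \<bullet> (idt ?H \<odot> ?x)) P (w \<bullet> (idt ?H \<odot> ?y)) =
      diag h M z P w \<bullet> (idt ?H \<odot> diag h M ?x P ?y)"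
    using diag_comp[of h h M P ?x ?y z w] by simp
  also have "diag h M ?x P ?y = diag b M x P y \<bullet> (t \<odot> idt M \<odot> idt P)"
    by (subst diag_pullback[OF t]) simp_all
  finally show ?thesis by (simp add: tns_idt)
qed

section \<open>Hopf algebras and their modules\<close>

definition unit_arrow :: "('o, 'm, 'y) alg_coalg_scheme \<Rightarrow> ('o, 'm) arrow"
  where "unit_arrow X = Arrow \<K> (\<eta> X) (obj X)"

definition mult_arrow :: "('o, 'm, 'y) alg_coalg_scheme \<Rightarrow> ('o, 'm) arrow"
  where "mult_arrow X = Arrow (obj X \<boxtimes> obj X) (\<mu> X) (obj X)"

definition counit_arrow :: "('o, 'm, 'y) alg_coalg_scheme \<Rightarrow> ('o, 'm) arrow"
  where "counit_arrow X = Arrow (obj X) (\<epsilon> X) \<K>"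

definition comult_arrow :: "('o, 'm, 'y) alg_coalg_scheme \<Rightarrow> ('o, 'm) arrow"
  where "comult_arrow X = Arrow (obj X) (\<delta> X) (obj X \<boxtimes> obj X)"

definition action_arrow :: "('o, 'm, 'y) alg_coalg_scheme \<Rightarrow> 'o \<Rightarrow> 'm \<Rightarrow> ('o, 'm) arrow"
  where "action_arrow X M f = Arrow (obj X \<boxtimes> M) f M"

lemma hopf_projections [simp]:
  "dm (unit_arrow X) = \<K>" "mor (unit_arrow X) = \<eta> X" "cd (unit_arrow X) = obj X"
  "dm (mult_arrow X) = obj X \<boxtimes> obj X" "mor (mult_arrow X) = \<mu> X" "cd (mult_arrow X) = obj X"
  "dm (counit_arrow X) = obj X" "mor (counit_arrow X) = \<epsilon> X" "cd (counit_arrow X) = \<K>"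
  "dm (comult_arrow X) = obj X" "mor (comult_arrow X) = \<delta> X" "cd (comult_arrow X) = obj X \<boxtimes> obj X"
  "dm (action_arrow X M f) = obj X \<boxtimes> M" "mor (action_arrow X M f) = f" "cd (action_arrow X M f) = M"
  by (simp_all add: unit_arrow_def mult_arrow_def counit_arrow_def comult_arrow_def action_arrow_def)

lemma arrow_eq_iff: "F = G \<longleftrightarrow> dm F = dm G \<and> mor F = mor G \<and> cd F = cd G"
  using arrow.expand by auto

lemma arr_iff:
  "arr (Arrow X f Y) \<longleftrightarrow> X \<in> Ob C \<and> Y \<in> Ob C \<and> f \<in> Hom C X Y"
  by (auto simp add: arr_def simp del: arr_Ob)

text \<open>That the comultiplication is an algebra morphism is read the other way round: the unit
  and the product are comultiplicative.\<close>

lemma hopf_algebraD: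
  assumes "hopf_algebra C X"
  shows "obj X \<in> Ob C" "arr (unit_arrow X)" "arr (mult_arrow X)" "arr (counit_arrow X)"
    "comult (comult_arrow X)"
    "(comult_arrow X \<odot> idt (obj X)) \<bullet> comult_arrow X = (idt (obj X) \<odot> comult_arrow X) \<bullet> comult_arrow X"
    "(counit_arrow X \<odot> idt (obj X)) \<bullet> comult_arrow X = idt (obj X)"
    "(idt (obj X) \<odot> counit_arrow X) \<bullet> comult_arrow X = idt (obj X)"
    "comult_hom (idt \<K>) (comult_arrow X) (unit_arrow X)"
    "comult_hom (tensor_comul (comult_arrow X) (comult_arrow X)) (comult_arrow X) (mult_arrow X)"
    "counit_arrow X \<bullet> unit_arrow X = idt \<K>"
    "counit_arrow X \<bullet> mult_arrow X = counit_arrow X \<odot> counit_arrow X"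
proof -
  let ?d = "comult_arrow X" let ?m = "mult_arrow X" let ?u = "unit_arrow X" let ?e = "counit_arrow X"
  note defs = assms[unfolded hopf_algebra_def algebra_coalgebra_def is_algebra_def is_coalgebra_def
      algebra_morphism_def tensor_mult_def]
  show [simp]: "obj X \<in> Ob C" using defs by simp
  then show [simp]: "arr ?u" "arr ?m" "arr ?e"
    using defs by (simp_all add: unit_arrow_def mult_arrow_def counit_arrow_def arr_iff)
  have [simp]: "arr ?d"
    using defs by (simp add: comult_arrow_def arr_iff)
  then show [simp]: "comult ?d" by (simp add: comultI)
  show "(?d \<odot> idt (obj X)) \<bullet> ?d = (idt (obj X) \<odot> ?d) \<bullet> ?d" "(?e \<odot> idt (obj X)) \<bullet> ?d = idt (obj X)"
    "(idt (obj X) \<odot> ?e) \<bullet> ?d = idt (obj X)" "?e \<bullet> ?u = idt \<K>"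
    using defs by (simp_all add: arrow_eq_iff)
  have [simp]: "comult (idt \<K>)" by (simp add: comultI)
  have "?d \<bullet> ?u = ?u \<odot> ?u"
    using defs by (simp add: arrow_eq_iff)
  then show "comult_hom (idt \<K>) ?d ?u"
    by (simp add: comult_hom_def)
  \<comment> \<open>The grouping of \<open>tensor_mult\<close> is kept for the match with the
    bialgebra axiom, hence without \<open>cmp_assoc\<close>.\<close>
  have "?d \<bullet> ?m = ((?m \<odot> ?m) \<bullet> mid (obj X) (obj X) (obj X) (obj X)) \<bullet> (?d \<odot> ?d)"
    using defs by (simp add: arrow_eq_iff mid_def del: cmp_assoc)
  then have "?d \<bullet> ?m = (?m \<odot> ?m) \<bullet> tensor_comul ?d ?d"
    by (simp add: tensor_comul_def)
  then show "comult_hom (tensor_comul ?d ?d) ?d ?m"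
    by (simp add: comult_hom_def)
  \<comment> \<open>\<open>idt \<K>\<close> is the product of the unit algebra, kept until the axiom
    has been matched.\<close>
  have "?e \<bullet> ?m = idt \<K> \<bullet> (?e \<odot> ?e)"
    using defs by (simp add: arrow_eq_iff del: cmp_idt)
  then show "?e \<bullet> ?m = ?e \<odot> ?e" by simp
qed

section \<open>Modules and their morphisms expressed through typed arrows\<close>

lemma left_module_iff:
  assumes "hopf_algebra C X"
  shows "left_module C X M x \<longleftrightarrow> left_mod (unit_arrow X) (mult_arrow X) M (action_arrow X M x)"
proof (cases "M \<in> Ob C")
  case True
  note [simp] = hopf_algebraD(1-3)[OF assms]
  have "arr (action_arrow X M x) \<longleftrightarrow> x \<in> Hom C (obj X \<boxtimes> M) M"
    using True by (simp add: action_arrow_def arr_iff)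
  with True show ?thesis
    by (simp add: left_module_def left_mod_def arrow_eq_iff)
qed (simp add: left_module_def left_mod_def)

lemma action_arrow_diagonal:
  assumes "hopf_algebra C X" "M \<in> Ob C" "P \<in> Ob C"
  shows "action_arrow X (M \<boxtimes> P) (diagonal_action C X M x P y) =
    diag (comult_arrow X) M (action_arrow X M x) P (action_arrow X P y)"
  using assms hopf_algebraD(1,5)[OF assms(1)]
  by (simp add: arrow_eq_iff diagonal_action_def) (simp add: diag_def mid_def)

lemma module_morphism_iff:
  assumes "hopf_algebra C X" "M \<in> Ob C" "M' \<in> Ob C"
  shows "module_morphism C X M x M' x' f \<longleftrightarrow> arr (Arrow M f M') \<and>
    Arrow M f M' \<bullet> action_arrow X M x = action_arrow X M' x' \<bullet> (idt (obj X) \<odot> Arrow M f M')"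
  using assms hopf_algebraD(1)[OF assms(1)]
  by (simp add: module_morphism_def arr_iff arrow_eq_iff)

lemma module_morphism_ident:
  assumes "hopf_algebra C X" "left_module C X M x"
  shows "module_morphism C X M x M x (ID M)"
proof -
  have x: "left_mod (unit_arrow X) (mult_arrow X) M (action_arrow X M x)"
    using assms by (simp add: left_module_iff)
  note [simp] = left_modD(1-4)[OF x] hopf_algebraD(1)[OF assms(1)]
  have "Arrow M (ID M) M = idt M" by (simp add: idt_def)
  then show ?thesis
    by (simp add: module_morphism_iff[OF assms(1)] flip: tns_idt)
qed

lemma module_morphism_compose:
  assumes X: "hopf_algebra C X" and "left_module C X L l" "left_module C X M x" "left_module C X P y"
    and f: "module_morphism C X L l M x f" and g: "module_morphism C X M x P y g"
  shows "module_morphism C X L l P y (g \<cdot> f)"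
proof -
  have m: "left_mod (unit_arrow X) (mult_arrow X) L (action_arrow X L l)"
    "left_mod (unit_arrow X) (mult_arrow X) M (action_arrow X M x)"
    "left_mod (unit_arrow X) (mult_arrow X) P (action_arrow X P y)"
    using assms by (simp_all add: left_module_iff)
  note [simp] = left_modD(1,2)[OF m(1)] left_modD(1,2)[OF m(2)] left_modD(1,2)[OF m(3)]
    hopf_algebraD(1)[OF X]
  let ?f = "Arrow L f M" and ?g = "Arrow M g P"
  have [simp]: "arr ?f" "arr ?g"
    and f: "?f \<bullet> action_arrow X L l = action_arrow X M x \<bullet> (idt (obj X) \<odot> ?f)"
    and g: "?g \<bullet> action_arrow X M x = action_arrow X P y \<bullet> (idt (obj X) \<odot> ?g)"
    using f g by (simp_all add: module_morphism_iff[OF X])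
  have gf: "Arrow L (g \<cdot> f) P = ?g \<bullet> ?f" by (simp add: arrow_eq_iff)
  have "(?g \<bullet> ?f) \<bullet> action_arrow X L l = (?g \<bullet> action_arrow X M x) \<bullet> (idt (obj X) \<odot> ?f)"
    by (simp add: f)
  also have "\<dots> = action_arrow X P y \<bullet> (idt (obj X) \<odot> (?g \<bullet> ?f))"
    unfolding g by (simp add: whisker)
  finally show ?thesis
    by (simp add: module_morphism_iff[OF X] gf)
qed

text \<open>Postcomposition and precomposition both act factorwise on \<open>diag\<close>, by
  \<open>diag_post\<close> and by \<open>diag_natural\<close> over an identity.\<close>

lemma module_morphism_tensor:
  assumes X: "hopf_algebra C X" and "left_module C X M x" "left_module C X M' x'"
    "left_module C X P y" "left_module C X P' y'"
    and f: "module_morphism C X M x M' x' f" and g: "module_morphism C X P y P' y' g"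
  shows "module_morphism C X (M \<boxtimes> P) (diagonal_action C X M x P y)
    (M' \<boxtimes> P') (diagonal_action C X M' x' P' y') (f \<otimes> g)"
proof -
  have m: "left_mod (unit_arrow X) (mult_arrow X) M (action_arrow X M x)"
    "left_mod (unit_arrow X) (mult_arrow X) M' (action_arrow X M' x')"
    "left_mod (unit_arrow X) (mult_arrow X) P (action_arrow X P y)"
    "left_mod (unit_arrow X) (mult_arrow X) P' (action_arrow X P' y')"
    using assms by (simp_all add: left_module_iff)
  note [simp] = left_modD(1,2)[OF m(1)] left_modD(1,2)[OF m(2)] left_modD(1,2)[OF m(3)]
    left_modD(1,2)[OF m(4)] hopf_algebraD(1,5)[OF X]
  let ?f = "Arrow M f M'" and ?g = "Arrow P g P'" and ?d = "comult_arrow X"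
  have [simp]: "arr ?f" "arr ?g"
    and f: "?f \<bullet> action_arrow X M x = action_arrow X M' x' \<bullet> (idt (obj X) \<odot> ?f)"
    and g: "?g \<bullet> action_arrow X P y = action_arrow X P' y' \<bullet> (idt (obj X) \<odot> ?g)"
    using f g by (simp_all add: module_morphism_iff[OF X])
  have fg: "Arrow (M \<boxtimes> P) (f \<otimes> g) (M' \<boxtimes> P') = ?f \<odot> ?g" by (simp add: arrow_eq_iff)
  have "(?f \<odot> ?g) \<bullet> diag ?d M (action_arrow X M x) P (action_arrow X P y) =
      diag ?d M (?f \<bullet> action_arrow X M x) P (?g \<bullet> action_arrow X P y)"
    by (rule diag_post) simp_all
  also have "\<dots> = diag ?d M' (action_arrow X M' x') P' (action_arrow X P' y') \<bullet> (idt (obj X) \<odot> ?f \<odot> ?g)"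
    unfolding f g
    using diag_natural[OF comult_hom_idt, of ?d ?f ?g "action_arrow X M' x'" "action_arrow X P' y'"]
    by simp
  finally show ?thesis
    by (simp add: module_morphism_iff[OF X] fg action_arrow_diagonal[OF X])
qed

lemma module_morphism_braid:
  assumes X: "hopf_algebra C X" and "cocommutative C X" "left_module C X M x" "left_module C X P y"
  shows "module_morphism C X (M \<boxtimes> P) (diagonal_action C X M x P y)
    (P \<boxtimes> M) (diagonal_action C X P y M x) (braid C M P)"
proof -
  have m: "left_mod (unit_arrow X) (mult_arrow X) M (action_arrow X M x)"
    "left_mod (unit_arrow X) (mult_arrow X) P (action_arrow X P y)"
    using assms by (simp_all add: left_module_iff)
  note [simp] = left_modD(1,2)[OF m(1)] left_modD(1,2)[OF m(2)] hopf_algebraD(1,5)[OF X]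
  have "brd (obj X) (obj X) \<bullet> comult_arrow X = comult_arrow X"
    using assms(2) by (simp add: cocommutative_def arrow_eq_iff)
  then have "brd M P \<bullet> diag (comult_arrow X) M (action_arrow X M x) P (action_arrow X P y) =
      diag (comult_arrow X) P (action_arrow X P y) M (action_arrow X M x) \<bullet> (idt (obj X) \<odot> brd M P)"
    using brd_diag[of "comult_arrow X" M P "action_arrow X M x" "action_arrow X P y"] by simp
  moreover have "Arrow (M \<boxtimes> P) (braid C M P) (P \<boxtimes> M) = brd M P" by (simp add: brd_def)
  ultimately show ?thesis
    by (simp add: module_morphism_iff[OF X] action_arrow_diagonal[OF X])
qed

text \<open>Stated for bare morphisms, so that the tensor product of module tuples becomes strictly
  associative.\<close>

lemma diagonal_action_assoc:
  assumes X: "hopf_algebra C X" and "left_module C X M x" "left_module C X P y" "left_module C X R z"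
  shows "diagonal_action C X (M \<boxtimes> P) (diagonal_action C X M x P y) R z =
    diagonal_action C X M x (P \<boxtimes> R) (diagonal_action C X P y R z)"
proof -
  have m: "left_mod (unit_arrow X) (mult_arrow X) M (action_arrow X M x)"
    "left_mod (unit_arrow X) (mult_arrow X) P (action_arrow X P y)"
    "left_mod (unit_arrow X) (mult_arrow X) R (action_arrow X R z)"
    using assms by (simp_all add: left_module_iff)
  note [simp] = left_modD(1,2)[OF m(1)] left_modD(1,2)[OF m(2)] left_modD(1,2)[OF m(3)]
    hopf_algebraD(1,5)[OF X]
  \<comment> \<open>The object keeps its bracketing so that \<open>action_arrow_diagonal\<close> can
    unfold the outer action.\<close>
  have "action_arrow X ((M \<boxtimes> P) \<boxtimes> R) (diagonal_action C X (M \<boxtimes> P) (diagonal_action C X M x P y) R z) =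
    action_arrow X (M \<boxtimes> P \<boxtimes> R) (diagonal_action C X M x (P \<boxtimes> R) (diagonal_action C X P y R z))"
    using hopf_algebraD(6)[OF X]
    by (simp add: action_arrow_diagonal[OF X] diag_assoc del: strict_assoc_ob)
  then show ?thesis by (simp add: action_arrow_def)
qed

lemma diagonal_action_counit:
  assumes X: "hopf_algebra C X" and "left_module C X M x"
  shows "diagonal_action C X \<K> (\<epsilon> X) M x = x" and "diagonal_action C X M x \<K> (\<epsilon> X) = x"
proof -
  have m: "left_mod (unit_arrow X) (mult_arrow X) M (action_arrow X M x)"
    using assms by (simp_all add: left_module_iff)
  note [simp] = left_modD(1,2)[OF m(1)] hopf_algebraD(1-5,7,8)[OF X]
  have [simp]: "action_arrow X \<K> (\<epsilon> X) = counit_arrow X"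
    by (simp add: action_arrow_def counit_arrow_def)
  have "action_arrow X (\<K> \<boxtimes> M) (diagonal_action C X \<K> (\<epsilon> X) M x) = action_arrow X M x"
    "action_arrow X (M \<boxtimes> \<K>) (diagonal_action C X M x \<K> (\<epsilon> X)) = action_arrow X M x"
    by (simp_all add: action_arrow_diagonal[OF X] diag_counit del: strict_lunit_ob strict_runit_ob)
  then show "diagonal_action C X \<K> (\<epsilon> X) M x = x" "diagonal_action C X M x \<K> (\<epsilon> X) = x"
    by (simp_all add: action_arrow_def)
qed

lemma left_module_diagonal:
  assumes "hopf_algebra C X" "left_module C X M x" "left_module C X P y"
  shows "left_module C X (M \<boxtimes> P) (diagonal_action C X M x P y)"
proof -
  have "M \<in> Ob C" "P \<in> Ob C" using assms by (simp_all add: left_module_def)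
  then show ?thesis
    using assms left_mod_diag[OF hopf_algebraD(9,10)[OF assms(1)]]
    by (simp add: left_module_iff action_arrow_diagonal)
qed

end

section \<open>Identities as isomorphisms\<close>

lemma (in category) is_inverse_ident:
  "X \<in> Ob C \<Longrightarrow> is_inverse C X X (ID X) (ID X)"
  by (simp add: is_inverse_def ident_hom ident_left[OF _ _ ident_hom])

text \<open>Makes the definite description in \<open>inverse_hom\<close> computable for strict
  associators, as required by the second hexagon.\<close>

lemma (in category) inverse_hom_ident:
  assumes "X \<in> Ob C" shows "inverse_hom C X X (ID X) = ID X"
  unfolding inverse_hom_def
proof (rule the_equality)
  fix g assume "is_inverse C X X (ID X) g"
  then show "g = ID X"
    using assms ident_left[of X X g] by (simp add: is_inverse_def)
qed (use assms is_inverse_ident in simp)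
section \<open>Modules over a relative Rota-Baxter operator\<close>

locale cocommutative_rota_baxter = strict_symmetric_category C
  for C :: "('o, 'm, 'z) braided_data_scheme" (structure) +
  fixes H B :: "('o, 'm) hopf" and T a :: 'm
  assumes rota_baxter: "relative_rota_baxter C H B T a"
    and cocommutative: "cocommutative C H" "cocommutative C B"
begin

abbreviation "\<delta>\<^sub>H \<equiv> comult_arrow H"
abbreviation "\<delta>\<^sub>B \<equiv> comult_arrow B"
abbreviation "act \<equiv> action_arrow B (obj H) a"
abbreviation "T_arrow \<equiv> Arrow (obj H) T (obj B)"

lemma hopf: "hopf_algebra C H" "hopf_algebra C B"
  using rota_baxter by (simp_all add: relative_rota_baxter_def)

lemmas [simp] = hopf_algebraD(1-5)[OF hopf(1)] hopf_algebraD(1-5)[OF hopf(2)]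

text \<open>Where cocommutativity enters the module conditions: \<delta> of \<open>B\<close> serves
  the compatibility of the two actions, \<delta> of \<open>H\<close> the condition involving
  \<open>T\<close>.\<close>

lemma comult_homs:
  "comult_hom \<delta>\<^sub>H (tensor_comul \<delta>\<^sub>H \<delta>\<^sub>H) \<delta>\<^sub>H" "comult_hom \<delta>\<^sub>B (tensor_comul \<delta>\<^sub>B \<delta>\<^sub>B) \<delta>\<^sub>B"
  using hopf_algebraD(6)[OF hopf(1)] hopf_algebraD(6)[OF hopf(2)] cocommutative
  by (auto intro!: comult_hom_comult simp: cocommutative_def arrow_eq_iff)

lemma arr_act [simp]: "arr act"
  using rota_baxter
  by (simp add: relative_rota_baxter_def module_algebra_coalgebra_def left_module_iff[OF hopf(2)] left_mod_def)

lemma comult_hom_act: "comult_hom (tensor_comul \<delta>\<^sub>B \<delta>\<^sub>H) \<delta>\<^sub>H act"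
proof -
  have "\<delta>\<^sub>H \<bullet> act = (act \<odot> act) \<bullet> tensor_comul \<delta>\<^sub>B \<delta>\<^sub>H"
    using rota_baxter
    by (simp add: relative_rota_baxter_def module_algebra_coalgebra_def coalgebra_morphism_def
        tensor_comult_def arrow_eq_iff) (simp add: tensor_comul_def mid_def)
  then show ?thesis by (simp add: comult_hom_def)
qed

lemma arr_T [simp]: "arr T_arrow"
  using rota_baxter by (simp add: relative_rota_baxter_def coalgebra_morphism_def arr_iff)

lemma comult_hom_T: "comult_hom \<delta>\<^sub>H \<delta>\<^sub>B T_arrow"
proof -
  have "\<delta>\<^sub>B \<bullet> T_arrow = (T_arrow \<odot> T_arrow) \<bullet> \<delta>\<^sub>H"
    using rota_baxter
    by (simp add: relative_rota_baxter_def coalgebra_morphism_def arrow_eq_iff)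
  then show ?thesis by (simp add: comult_hom_def)
qed

section \<open>The unit module and tensor products of modules\<close>

lemma is_rb_module_iff:
  "is_rb_module C H B T a (M, N, z, x, n, g) \<longleftrightarrow>
    left_module C H M z \<and> left_module C B M x \<and> left_module C B N n \<and> arr (Arrow M g N) \<and>
    action_arrow B M x \<bullet> (idt (obj B) \<odot> action_arrow H M z) =
      action_arrow H M z \<bullet> (act \<odot> action_arrow B M x) \<bullet>
      (idt (obj B) \<odot> brd (obj B) (obj H) \<odot> idt M) \<bullet> (\<delta>\<^sub>B \<odot> idt (obj H) \<odot> idt M) \<and>
    action_arrow B N n \<bullet> (T_arrow \<odot> Arrow M g N) =
      Arrow M g N \<bullet> action_arrow H M z \<bullet>
      (idt (obj H) \<odot> (action_arrow B M x \<bullet> (T_arrow \<odot> idt M))) \<bullet> (\<delta>\<^sub>H \<odot> idt M)"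
proof (cases "M \<in> Ob C \<and> N \<in> Ob C")
  case True
  then show ?thesis
    by (auto simp add: is_rb_module_def arrow_eq_iff arr_iff)
next
  case False
  then show ?thesis
    by (auto simp add: is_rb_module_def left_module_def)
qed

text \<open>All actions are counits, and products, \<open>act\<close> and \<open>T\<close> preserve
  counits; hence both sides of every condition collapse to tensor products of counits.\<close>

lemma rb_module_unit: "is_rb_module C H B T a (\<K>, \<K>, \<epsilon> H, \<epsilon> B, \<epsilon> B, ID \<K>)"
proof -
  have [simp]: "action_arrow H \<K> (\<epsilon> H) = counit_arrow H" "action_arrow B \<K> (\<epsilon> B) = counit_arrow B"
    "Arrow \<K> (ID \<K>) \<K> = idt \<K>"
    by (simp_all add: action_arrow_def counit_arrow_def idt_def)
  have lm: "left_module C X \<K> (\<epsilon> X)" if X: "hopf_algebra C X" for X :: "('o, 'm) hopf"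
  proof -
    have [simp]: "action_arrow X \<K> (\<epsilon> X) = counit_arrow X"
      using hopf_algebraD(1)[OF X] by (simp add: action_arrow_def counit_arrow_def)
    have "counit_arrow X \<odot> counit_arrow X = counit_arrow X \<bullet> (idt (obj X) \<odot> counit_arrow X)"
      using tns_cmp[of "idt \<K>" "counit_arrow X" "counit_arrow X" "idt (obj X)"]
        tns_cmp[of "counit_arrow X" "idt (obj X)" "idt \<K>" "counit_arrow X"] hopf_algebraD(1,4)[OF X]
      by simp
    with hopf_algebraD[OF X] show ?thesis
      by (simp add: left_module_iff[OF X] left_mod_def)
  qed
  have e: "counit_arrow H \<bullet> act = counit_arrow B \<odot> counit_arrow H" "counit_arrow B \<bullet> T_arrow = counit_arrow H"
    using rota_baxter
    by (simp_all add: relative_rota_baxter_def module_algebra_coalgebra_def coalgebra_morphism_def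
        arrow_eq_iff)
  \<comment> \<open>Since counits end in \<K>, interchange with \<open>idt \<K>\<close> lets them be
    applied one after the other.\<close>
  have 1: "counit_arrow X \<bullet> (idt (obj X) \<odot> counit_arrow Y) = counit_arrow X \<odot> counit_arrow Y"
     "counit_arrow Y \<bullet> (counit_arrow X \<odot> idt (obj Y)) = counit_arrow X \<odot> counit_arrow Y"
    if "hopf_algebra C X" "hopf_algebra C Y" for X Y :: "('o, 'm) hopf"
      using tns_cmp[of "idt \<K>" "counit_arrow X" "counit_arrow Y" "idt (obj Y)"]
        tns_cmp[of "counit_arrow X" "idt (obj X)" "idt \<K>" "counit_arrow Y"]
        hopf_algebraD(1,4)[OF that(1)] hopf_algebraD(1,4)[OF that(2)]
      by simp_all
  \<comment> \<open>In Sweedler notation: \<epsilon>(b_1 . h) \<epsilon>(b_2) = \<epsilon>(b)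
    \<epsilon>(h).\<close>
  have "counit_arrow H \<bullet> (act \<odot> counit_arrow B) \<bullet> (idt (obj B) \<odot> brd (obj B) (obj H)) \<bullet> (\<delta>\<^sub>B \<odot> idt (obj H)) =
      ((counit_arrow H \<bullet> act) \<odot> counit_arrow B) \<bullet> (idt (obj B) \<odot> brd (obj B) (obj H)) \<bullet> (\<delta>\<^sub>B \<odot> idt (obj H))"
    using tns_cmp_cmp[of "counit_arrow H" act "idt \<K>" "counit_arrow B"
        "(idt (obj B) \<odot> brd (obj B) (obj H)) \<bullet> (\<delta>\<^sub>B \<odot> idt (obj H))"]
    by simp
  also have "\<dots> = (counit_arrow B \<odot> ((counit_arrow H \<odot> counit_arrow B) \<bullet> brd (obj B) (obj H))) \<bullet> (\<delta>\<^sub>B \<odot> idt (obj H))"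
    by (simp add: e tns_cmp_cmp)
  also have "(counit_arrow H \<odot> counit_arrow B) \<bullet> brd (obj B) (obj H) = counit_arrow B \<odot> counit_arrow H"
    using brd_natural[of "counit_arrow B" "counit_arrow H"] by simp
  also have "(counit_arrow B \<odot> counit_arrow B \<odot> counit_arrow H) \<bullet> (\<delta>\<^sub>B \<odot> idt (obj H)) =
     ((counit_arrow B \<odot> counit_arrow B) \<bullet> \<delta>\<^sub>B) \<odot> counit_arrow H"
    using tns_cmp[of "counit_arrow B \<odot> counit_arrow B" \<delta>\<^sub>B "counit_arrow H" "idt (obj H)"] by simp
  also have "(counit_arrow B \<odot> counit_arrow B) \<bullet> \<delta>\<^sub>B = counit_arrow B \<bullet> (idt (obj B) \<odot> counit_arrow B) \<bullet> \<delta>\<^sub>B"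
    using 1(1)[OF hopf(2,2)] by (simp flip: cmp_assoc)
  finally have i: "counit_arrow H \<bullet> (act \<odot> counit_arrow B) \<bullet> (idt (obj B) \<odot> brd (obj B) (obj H)) \<bullet> (\<delta>\<^sub>B \<odot> idt (obj H)) =
     counit_arrow B \<odot> counit_arrow H"
    using hopf_algebraD(8)[OF hopf(2)] by simp
  show ?thesis
    using hopf_algebraD(7,8)[OF hopf(1)]
    by (simp add: is_rb_module_iff lm hopf i 1 e)
qed

lemma rb_module_tensor_closed:
  assumes "is_rb_module C H B T a (M, N, z, x, n, g)" "is_rb_module C H B T a (P, Q, w, y, q, f)"
  shows "is_rb_module C H B T a (M \<boxtimes> P, N \<boxtimes> Q, diagonal_action C H M z P w,
    diagonal_action C B M x P y, diagonal_action C B N n Q q, g \<otimes> f)"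
proof -
  note 1 = assms[unfolded is_rb_module_iff]
  have m: "left_mod (unit_arrow H) (mult_arrow H) M (action_arrow H M z)"
    "left_mod (unit_arrow B) (mult_arrow B) M (action_arrow B M x)"
    "left_mod (unit_arrow B) (mult_arrow B) N (action_arrow B N n)"
    "left_mod (unit_arrow H) (mult_arrow H) P (action_arrow H P w)"
    "left_mod (unit_arrow B) (mult_arrow B) P (action_arrow B P y)"
    "left_mod (unit_arrow B) (mult_arrow B) Q (action_arrow B Q q)"
    using 1 by (simp_all flip: left_module_iff add: hopf)
  note [simp] = m[THEN left_modD(1)] m[THEN left_modD(2)]
  have [simp]: "arr (Arrow M g N)" "arr (Arrow P f Q)" using 1 by simp_all
  have [simp]: "Arrow (M \<boxtimes> P) (g \<otimes> f) (N \<boxtimes> Q) = Arrow M g N \<odot> Arrow P f Q"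
    by (simp add: arrow_eq_iff)
  show ?thesis
    unfolding is_rb_module_iff
    using 1 left_module_diagonal hopf
      diag_compatible[of \<delta>\<^sub>B \<delta>\<^sub>H act M "action_arrow B M x" "action_arrow H M z" P "action_arrow B P y" "action_arrow H P w"]
      diag_rota_baxter[of \<delta>\<^sub>H \<delta>\<^sub>B T_arrow M "action_arrow B M x" "action_arrow H M z" P "action_arrow B P y" "action_arrow H P w"
         "action_arrow B N n" "Arrow M g N" "action_arrow B Q q" "Arrow P f Q"]
    by (simp add: action_arrow_diagonal comult_homs comult_hom_act comult_hom_T)
qed


section \<open>The category of modules, its morphisms and its tensor product\<close>

abbreviation "D \<equiv> rb_Mod C H B T a"

text \<open>With projections in place of tuple patterns, an equational axiom for \<open>D\<close>
  splits into two instances of the axiom for \<open>C\<close>.\<close>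

lemma rb_Mod_simps [simp]:
  "X \<in> Ob D \<longleftrightarrow> is_rb_module C H B T a X"
  "Hom D = rb_module_hom C H B"
  "ident D X = (ID (fst X), ID (fst (snd X)))"
  "compose D g f = (fst g \<cdot> fst f, snd g \<cdot> snd f)"
  "tensor_ob D = rb_module_tensor C H B"
  "tensor_hom D f g = (fst f \<otimes> fst g, snd f \<otimes> snd g)"
  "unit_ob D = (\<K>, \<K>, \<epsilon> H, \<epsilon> B, \<epsilon> B, ID \<K>)"
  "assoc D X Y Z = (assoc C (fst X) (fst Y) (fst Z), assoc C (fst (snd X)) (fst (snd Y)) (fst (snd Z)))"
  "lunit D X = (lunit C (fst X), lunit C (fst (snd X)))"
  "runit D X = (runit C (fst X), runit C (fst (snd X)))"
  "braid D X Y = (braid C (fst X) (fst Y), braid C (fst (snd X)) (fst (snd Y)))"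
  by (simp_all add: rb_Mod_def case_prod_beta)

lemma rb_module_tensor_simp [simp]:
  "rb_module_tensor C H B (M, N, z, x, n, g) (P, Q, w, y, q, f) =
    (M \<boxtimes> P, N \<boxtimes> Q, diagonal_action C H M z P w, diagonal_action C B M x P y,
      diagonal_action C B N n Q q, g \<otimes> f)"
  by (simp add: rb_module_tensor_def)

lemma rb_module_tensor_ob [simp]:
  "fst (rb_module_tensor C H B X Y) = fst X \<boxtimes> fst Y"
  "fst (snd (rb_module_tensor C H B X Y)) = fst (snd X) \<boxtimes> fst (snd Y)"
  by (simp_all add: rb_module_tensor_def case_prod_beta)

lemma rb_module_hom_iff:
  "(r, s) \<in> rb_module_hom C H B (M, N, z, x, n, g) (P, Q, w, y, q, f) \<longleftrightarrow>
    module_morphism C H M z P w r \<and> module_morphism C B M x P y r \<and>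
    module_morphism C B N n Q q s \<and> s \<cdot> g = f \<cdot> r"
  by (simp add: rb_module_hom_def)

lemma rb_module_homD:
  assumes "f \<in> rb_module_hom C H B X Y"
  shows "fst f \<in> Hom C (fst X) (fst Y)" "snd f \<in> Hom C (fst (snd X)) (fst (snd Y))"
  using assms by (cases X; cases Y; cases f; simp add: rb_module_hom_iff module_morphism_def)+

lemma rb_moduleD:
  assumes "is_rb_module C H B T a (M, N, z, x, n, g)"
  shows "M \<in> Ob C" "N \<in> Ob C" "left_module C H M z" "left_module C B M x" "left_module C B N n"
    "g \<in> Hom C M N"
  using assms by (simp_all add: is_rb_module_def left_module_def)

lemma rb_module_obD:
  assumes "is_rb_module C H B T a X"
  shows "fst X \<in> Ob C" "fst (snd X) \<in> Ob C"
  using assms by (cases X; simp add: rb_moduleD)+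

lemma rb_ident_hom:
  assumes "is_rb_module C H B T a X" shows "ident D X \<in> rb_module_hom C H B X X"
proof -
  obtain M N z x n g where X: "X = (M, N, z, x, n, g)" by (cases X)
  note * = rb_moduleD[OF assms[unfolded X]]
  then show ?thesis
    by (simp add: X rb_module_hom_iff module_morphism_ident hopf ident_left[of M N] ident_right[of M N])
qed

lemma rb_compose_hom:
  assumes "is_rb_module C H B T a X" "is_rb_module C H B T a Y" "is_rb_module C H B T a Z"
    and "f \<in> rb_module_hom C H B X Y" "g \<in> rb_module_hom C H B Y Z"
  shows "compose D g f \<in> rb_module_hom C H B X Z"
proof -
  obtain M N z x n k where X: "X = (M, N, z, x, n, k)" by (cases X)
  obtain M' N' z' x' n' k' where Y: "Y = (M', N', z', x', n', k')" by (cases Y)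
  obtain M'' N'' z'' x'' n'' k'' where Z: "Z = (M'', N'', z'', x'', n'', k'')" by (cases Z)
  obtain r s r' s' where fg: "f = (r, s)" "g = (r', s')" by (cases f, cases g)
  note a = rb_moduleD[OF assms(1)[unfolded X]] rb_moduleD[OF assms(2)[unfolded Y]]
    rb_moduleD[OF assms(3)[unfolded Z]]
  note rs = assms(4,5)[unfolded X Y Z fg]
  note h = rs[THEN rb_module_homD(1), simplified] rs[THEN rb_module_homD(2), simplified]
  note m = rs[unfolded rb_module_hom_iff]
  \<comment> \<open>The two commuting squares are pasted; the objects are named because overlapping
    hom-sets do not determine them.\<close>
  have "(s' \<cdot> s) \<cdot> k = s' \<cdot> (s \<cdot> k)"
    using a h by (intro compose_assoc[of M N N' N'']) auto
  also have "\<dots> = s' \<cdot> k' \<cdot> r" using m by simp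
  also have "\<dots> = (s' \<cdot> k') \<cdot> r"
    using a h by (intro compose_assoc[of M M' N' N'', symmetric]) auto
  also have "\<dots> = k'' \<cdot> r' \<cdot> r"
    using a h m by (simp add: compose_assoc[of M M' M'' N''])
  finally have "(s' \<cdot> s) \<cdot> k = k'' \<cdot> r' \<cdot> r" .
  moreover have "module_morphism C H M z M'' z'' (r' \<cdot> r)" "module_morphism C B M x M'' x'' (r' \<cdot> r)"
    "module_morphism C B N n N'' n'' (s' \<cdot> s)"
    using module_morphism_compose[OF hopf(1), of M z M' z' M'' z'']
      module_morphism_compose[OF hopf(2), of M x M' x' M'' x'']
      module_morphism_compose[OF hopf(2), of N n N' n' N'' n''] a m by simp_all
  ultimately show ?thesis
    by (simp add: X Z fg rb_module_hom_iff)
qed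

lemma rb_tensor_hom:
  assumes "is_rb_module C H B T a X" "is_rb_module C H B T a X'" "is_rb_module C H B T a Y"
    "is_rb_module C H B T a Y'"
    and "f \<in> rb_module_hom C H B X X'" "g \<in> rb_module_hom C H B Y Y'"
  shows "tensor_hom D f g \<in> rb_module_hom C H B (rb_module_tensor C H B X Y) (rb_module_tensor C H B X' Y')"
proof -
  obtain M N z x n k where X: "X = (M, N, z, x, n, k)" by (cases X)
  obtain M' N' z' x' n' k' where X': "X' = (M', N', z', x', n', k')" by (cases X')
  obtain P Q w y q l where Y: "Y = (P, Q, w, y, q, l)" by (cases Y)
  obtain P' Q' w' y' q' l' where Y': "Y' = (P', Q', w', y', q', l')" by (cases Y')
  obtain r s r' s' where fg: "f = (r, s)" "g = (r', s')" by (cases f, cases g)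
  note a = rb_moduleD[OF assms(1)[unfolded X]] rb_moduleD[OF assms(2)[unfolded X']]
    rb_moduleD[OF assms(3)[unfolded Y]] rb_moduleD[OF assms(4)[unfolded Y']]
  note rs = assms(5)[unfolded X X' fg] assms(6)[unfolded Y Y' fg]
  note h = rs[THEN rb_module_homD(1), simplified] rs[THEN rb_module_homD(2), simplified]
  note m = rs(1)[unfolded rb_module_hom_iff] rs(2)[unfolded rb_module_hom_iff]
  have "(s \<otimes> s') \<cdot> (k \<otimes> l) = (s \<cdot> k) \<otimes> (s' \<cdot> l)"
    using a h by (intro tensor_compose[of M N N' P Q Q', symmetric]) auto
  also have "\<dots> = (k' \<cdot> r) \<otimes> (l' \<cdot> r')" using m by simp
  also have "\<dots> = (k' \<otimes> l') \<cdot> (r \<otimes> r')"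
    using a h by (intro tensor_compose[of M M' N' P P' Q']) auto
  finally have "(s \<otimes> s') \<cdot> (k \<otimes> l) = (k' \<otimes> l') \<cdot> (r \<otimes> r')" .
  then show ?thesis
    using a m by (simp add: X X' Y Y' fg rb_module_hom_iff module_morphism_tensor hopf)
qed

text \<open>Linearity of both components comes from cocommutativity, and the square with the
  structure maps from naturality of the braiding.\<close>

lemma rb_braid_hom:
  assumes "is_rb_module C H B T a X" "is_rb_module C H B T a Y"
  shows "braid D X Y \<in> rb_module_hom C H B (rb_module_tensor C H B X Y) (rb_module_tensor C H B Y X)"
proof -
  obtain M N z x n k where X: "X = (M, N, z, x, n, k)" by (cases X)
  obtain P Q w y q l where Y: "Y = (P, Q, w, y, q, l)" by (cases Y)
  note a = rb_moduleD[OF assms(1)[unfolded X]] rb_moduleD[OF assms(2)[unfolded Y]]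
  then show ?thesis
    by (simp add: X Y rb_module_hom_iff module_morphism_braid hopf cocommutative
        braid_natural[of M N P Q])
qed

text \<open>\<open>D\<close> inherits strictness: tensor products agree as whole tuples, so the
  associators are identities of \<open>D\<close> itself.\<close>

lemma rb_tensor_assoc:
  assumes "is_rb_module C H B T a X" "is_rb_module C H B T a Y" "is_rb_module C H B T a Z"
  shows "rb_module_tensor C H B (rb_module_tensor C H B X Y) Z =
      rb_module_tensor C H B X (rb_module_tensor C H B Y Z)"
    and "assoc D X Y Z = ident D (rb_module_tensor C H B X (rb_module_tensor C H B Y Z))"
proof -
  obtain M N z x n k where X: "X = (M, N, z, x, n, k)" by (cases X)
  obtain P Q w y q l where Y: "Y = (P, Q, w, y, q, l)" by (cases Y)
  obtain R S v u p m where Z: "Z = (R, S, v, u, p, m)" by (cases Z)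
  note a = rb_moduleD[OF assms(1)[unfolded X]] rb_moduleD[OF assms(2)[unfolded Y]]
    rb_moduleD[OF assms(3)[unfolded Z]]
  have "(k \<otimes> l) \<otimes> m = k \<otimes> l \<otimes> m"
    using tns_assoc[of "Arrow M k N" "Arrow P l Q" "Arrow R m S"] a
    by (simp add: arrow_eq_iff arr_iff del: tns_assoc)
  with a show "rb_module_tensor C H B (rb_module_tensor C H B X Y) Z =
      rb_module_tensor C H B X (rb_module_tensor C H B Y Z)"
    by (simp add: X Y Z diagonal_action_assoc hopf)
  show "assoc D X Y Z = ident D (rb_module_tensor C H B X (rb_module_tensor C H B Y Z))"
    using a by (simp add: X Y Z strict_assoc)
qed

lemma rb_tensor_unit:
  assumes "is_rb_module C H B T a X"
  shows "rb_module_tensor C H B (unit_ob D) X = X" "rb_module_tensor C H B X (unit_ob D) = X"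
    "lunit D X = ident D X" "runit D X = ident D X"
proof -
  obtain M N z x n k where X: "X = (M, N, z, x, n, k)" by (cases X)
  note a = rb_moduleD[OF assms[unfolded X]]
  have "ID \<K> \<otimes> k = k" "k \<otimes> ID \<K> = k"
    using tns_unit[of "Arrow M k N"] a
    by (simp_all add: arrow_eq_iff arr_iff del: tns_unit)
  with a show "rb_module_tensor C H B (unit_ob D) X = X" "rb_module_tensor C H B X (unit_ob D) = X"
    by (simp_all add: X diagonal_action_counit hopf)
  show "lunit D X = ident D X" "runit D X = ident D X"
    using a by (simp_all add: X strict_lunit strict_runit)
qed

lemma rb_tensor_module:
  "\<lbrakk>is_rb_module C H B T a X; is_rb_module C H B T a Y\<rbrakk> \<Longrightarrow>
    is_rb_module C H B T a (rb_module_tensor C H B X Y)"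
  by (cases X, cases Y) (simp add: rb_module_tensor_closed)

section \<open>Verification of the category, monoidal and symmetry axioms\<close>

lemma rb_category: "category D"
proof (rule category.intro, goal_cases)
  case (3 X Y f)
  then show ?case
    using ident_left[of "fst X" "fst Y" "fst f"]
      ident_left[of "fst (snd X)" "fst (snd Y)" "snd f"]
    by (simp add: rb_module_obD rb_module_homD)
next
  case (4 X Y f)
  then show ?case
    using ident_right[of "fst X" "fst Y" "fst f"]
      ident_right[of "fst (snd X)" "fst (snd Y)" "snd f"]
    by (simp add: rb_module_obD rb_module_homD)
next
  case (5 W X Y Z f g h)
  then show ?case
    using compose_assoc[of "fst W" "fst X" "fst Y" "fst Z" "fst f" "fst g" "fst h"]
      compose_assoc[of "fst (snd W)" "fst (snd X)" "fst (snd Y)" "fst (snd Z)" "snd f" "snd g" "snd h"]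
    by (simp add: rb_module_obD rb_module_homD)
qed (simp_all add: rb_ident_hom[simplified] rb_compose_hom[simplified])


text \<open>Invertibility in \<open>D\<close> requires the inverse to be a module morphism; for the
  strict constraints this lemma supplies it.\<close>

lemma is_iso_ident_rb: "is_rb_module C H B T a X \<Longrightarrow> is_iso D X X (ident D X)"
  unfolding is_iso_def by (rule exI, rule category.is_inverse_ident[OF rb_category]) simp

text \<open>Equations between morphisms are checked componentwise in \<open>C\<close>; module
  structure enters only through closure and the invertibility of the constraints.\<close>

lemma rb_monoidal: "monoidal_category D"
proof (intro monoidal_category.intro rb_category monoidal_category_axioms.intro, goal_cases)
  case 1
  then show ?case by (simp add: rb_module_unit)
next
  case (2 X Y)
  then show ?case by (simp add: rb_tensor_module)
next
  case (3 X X' Y Y' f g)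
  then show ?case by (simp add: rb_tensor_hom[simplified])
next
  case (4 X Y)
  then show ?case
    using tensor_ident[of "fst X" "fst Y" ]
      tensor_ident[of "fst (snd X)" "fst (snd Y)" ]
    by (simp add: rb_module_obD rb_module_homD)
next
  case (5 X X' X'' Y Y' Y'' f f' g g')
  then show ?case
    using tensor_compose[of "fst X" "fst X'" "fst X''" "fst Y" "fst Y'" "fst Y''" "fst f" "fst f'" "fst g" "fst g'"]
      tensor_compose[of "fst (snd X)" "fst (snd X')" "fst (snd X'')" "fst (snd Y)" "fst (snd Y')" "fst (snd Y'')" "snd f" "snd f'" "snd g" "snd g'"]
    by (simp add: rb_module_obD rb_module_homD)
next
  case (6 X Y Z)
  then show ?case
    using is_iso_ident_rb[of "rb_module_tensor C H B X (rb_module_tensor C H B Y Z)"]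
    by (simp add: rb_tensor_assoc rb_tensor_module rb_module_obD strict_assoc)
next
  case (7 X X' Y Y' Z Z' f g h)
  then show ?case
    using assoc_natural[of "fst X" "fst X'" "fst Y" "fst Y'" "fst Z" "fst Z'" "fst f" "fst g" "fst h"]
      assoc_natural[of "fst (snd X)" "fst (snd X')" "fst (snd Y)" "fst (snd Y')" "fst (snd Z)" "fst (snd Z')" "snd f" "snd g" "snd h"]
    by (simp add: rb_module_obD rb_module_homD)
next
  case (8 X)
  then show ?case
    using is_iso_ident_rb[of X] rb_tensor_unit[of X] by simp
next
  case (9 X X' f)
  then show ?case
    using lunit_natural[of "fst X" "fst X'" "fst f"]
      lunit_natural[of "fst (snd X)" "fst (snd X')" "snd f"]
    by (simp add: rb_module_obD rb_module_homD)
next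
  case (10 X)
  then show ?case
    using is_iso_ident_rb[of X] rb_tensor_unit[of X] by simp
next
  case (11 X X' f)
  then show ?case
    using runit_natural[of "fst X" "fst X'" "fst f"]
      runit_natural[of "fst (snd X)" "fst (snd X')" "snd f"]
    by (simp add: rb_module_obD rb_module_homD)
next
  case (12 W X Y Z)
  then show ?case
    using pentagon[of "fst W" "fst X" "fst Y" "fst Z" ]
      pentagon[of "fst (snd W)" "fst (snd X)" "fst (snd Y)" "fst (snd Z)" ]
    by (simp add: rb_module_obD rb_module_homD del: strict_assoc_ob)
next
  case (13 X Y)
  then show ?case
    using triangle[of "fst X" "fst Y" ]
      triangle[of "fst (snd X)" "fst (snd Y)" ]
    by (simp add: rb_module_obD rb_module_homD)
qed

lemma rb_braid_sym:
  assumes "is_rb_module C H B T a X" "is_rb_module C H B T a Y"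
  shows "compose D (braid D Y X) (braid D X Y) = ident D (rb_module_tensor C H B X Y)"
  using assms by (simp add: rb_module_obD braid_symmetric)

lemma rb_symmetric: "symmetric_monoidal_category D"
proof (intro symmetric_monoidal_category.intro braided_monoidal_category.intro rb_monoidal
    braided_monoidal_category_axioms.intro symmetric_monoidal_category_axioms.intro, goal_cases)
  case (1 X Y)
  \<comment> \<open>By symmetry the inverse is the opposite braiding, already known to be a module
    morphism.\<close>
  then have "is_inverse D (rb_module_tensor C H B X Y) (rb_module_tensor C H B Y X) (braid D X Y) (braid D Y X)"
    by (simp add: is_inverse_def rb_braid_hom[simplified] rb_braid_sym[simplified])
  then show ?case unfolding is_iso_def rb_Mod_simps by (rule exI)
next
  case (2 X X' Y Y' f g)
  then show ?case
    using braid_natural[of "fst X" "fst X'" "fst Y" "fst Y'" "fst f" "fst g"]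
      braid_natural[of "fst (snd X)" "fst (snd X')" "fst (snd Y)" "fst (snd Y')" "snd f" "snd g"]
    by (simp add: rb_module_obD rb_module_homD)
next
  case (3 X Y Z)
  then show ?case
    using hexagon[of "fst X" "fst Y" "fst Z" ]
      hexagon[of "fst (snd X)" "fst (snd Y)" "fst (snd Z)" ]
    by (simp add: rb_module_obD rb_module_homD del: strict_assoc_ob)
next
  case (4 X Y Z)
  \<comment> \<open>An inverse in \<open>D\<close> is a definite description over pairs and does not
    split into components by unfolding. Strictness evaluates it to an identity, and
    \<open>inv'\<close> does the same in \<open>C\<close>.\<close>
  have inv: "inverse_hom D (rb_module_tensor C H B (rb_module_tensor C H B U V) W)
      (rb_module_tensor C H B U (rb_module_tensor C H B V W)) (assoc D U V W) =
      ident D (rb_module_tensor C H B U (rb_module_tensor C H B V W))"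
    if "is_rb_module C H B T a U" "is_rb_module C H B T a V" "is_rb_module C H B T a W" for U V W
    using that category.inverse_hom_ident[OF rb_category, of "rb_module_tensor C H B U (rb_module_tensor C H B V W)"]
    by (simp add: rb_tensor_assoc rb_tensor_module rb_module_obD strict_assoc)
  have inv': "inverse_hom C ((U \<boxtimes> V) \<boxtimes> W) (U \<boxtimes> V \<boxtimes> W) (assoc C U V W) = ID (U \<boxtimes> V \<boxtimes> W)"
    if "U \<in> Ob C" "V \<in> Ob C" "W \<in> Ob C" for U V W
    using that by (simp add: strict_assoc inverse_hom_ident)
  have hex: "ID (Z \<boxtimes> X \<boxtimes> Y) \<cdot> braid C (X \<boxtimes> Y) Z \<cdot> ID (X \<boxtimes> Y \<boxtimes> Z) =
      (braid C X Z \<otimes> ID Y) \<cdot> ID (X \<boxtimes> Z \<boxtimes> Y) \<cdot> (ID X \<otimes> braid C Y Z)"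
    if "X \<in> Ob C" "Y \<in> Ob C" "Z \<in> Ob C" for X Y Z
    using hexagon_inverse[OF that] unfolding inv'[OF that] inv'[OF that(3,1,2)] inv'[OF that(1,3,2)] .
  show ?case
    using 4 inv[of X Y Z] inv[of Z X Y] inv[of X Z Y]
    by (simp add: rb_module_obD hex)
next
  case (5 X Y)
  then show ?case by (simp add: rb_braid_sym[simplified])
qed

end

theorem theorem2p10:
  fixes C :: "('o, 'm, 'z) braided_data_scheme"
    and H B :: "('o, 'm) hopf"
    and T \<phi>\<^sub>H :: 'm
  assumes "strict_monoidal_category C"
    and "symmetric_monoidal_category C"
    and "relative_rota_baxter C H B T \<phi>\<^sub>H"
    and "cocommutative C H"
    and "cocommutative C B"
  shows "monoidal_category (rb_Mod C H B T \<phi>\<^sub>H) \<and>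
         symmetric_monoidal_category (rb_Mod C H B T \<phi>\<^sub>H)"
proof -
  interpret cocommutative_rota_baxter C H B T \<phi>\<^sub>H
    using assms by (intro cocommutative_rota_baxter.intro strict_symmetric_category.intro
        cocommutative_rota_baxter_axioms.intro)
  show ?thesis using rb_monoidal rb_symmetric by simp
qed

end
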